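(* Let $K$ be a field (with the standing assumption on $\mathrm{char}(K)$ given in the context) and let $I\subset S=K[x_1,\dots,x_n]$ be a squarefree monomial ideal generated in degree $d$. Let $\mu(I)$ be the minimal number of generators of $I$, and assume that $$\mu(I)\ge\binom{n}{d}-2d+1\quad\text{and}\quad n\ge 2d.$$ Then $\partial^\ell(I)$ is vertex splittable and $\mathrm{reg}\,\partial^\ell(I)=d-\ell$, for all $0\le\ell\le d$.
   Context: $S=K[x_1,\dots,x_n]$ is the standard graded polynomial ring over the field $K$. For a homogeneous ideal $I\subset S$, the gradient ideal $\partial(I)$ is the ideal generated by all partial derivatives $\partial f/\partial x_i$ ($1\le i\le n$) of the elements $f$ of a minimal generating set of $I$; $\partial^0(I)=I$, $\partial^1(I)=\partial(I)$ and $\partial^\ell(I)=\partial(\partial^{\ell-1}(I))$ for $\ell>1$. For a monomial ideal $I$, $\mathcal{G}(I)$ denotes its minimal monomial generating set (so $\mu(I)=|\mathcal{G}(I)|$), and $\mathrm{supp}(u)=\{i: x_i \text{ divides } u\}$ for a monomial $u$. "Generated in degree $d$" means that $I\ne 0$ and all monomials in $\mathcal{G}(I)$ have degree $d$. Standing assumption: $\mathrm{char}(K)=0$, or $\mathrm{char}(K)$ is large enough that for every monomial ideal $I$ under consideration $$\partial(I)=(u/x_i:\ u\in\mathcal{G}(I),\ i\in\mathrm{supp}(u)).$$ For a homogeneous ideal $I$, $\mathrm{reg}\,I=\max\{j-i:\ \dim_K\mathrm{Tor}^S_i(K,I)_j\neq 0\}$ is the Castelnuovo–Mumford regularity. A monomial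 ideal $I\subset S$ is vertex splittable if it can be obtained by the following recursive procedure: (i) if $u$ is a monomial and $I=(u)$, $I=(0)$ or $I=S$, then $I$ is vertex splittable; (ii) if there exist a variable $x_i$ and vertex splittable ideals $I_1\subset S$ and $I_2\subset K[x_1,\dots,x_{i-1},x_{i+1},\dots,x_n]$ such that $I=x_iI_1+I_2$, $I_2\subseteq I_1$ and $\mathcal{G}(I)$ is the disjoint union of $\mathcal{G}(x_iI_1)$ and $\mathcal{G}(I_2)$, then $I$ is vertex splittable. (Ideals generated by monomials in a subset of the variables are identified with their extensions to $S$.) *)

theory Defs
  imports "HOL-Library.Poly_Mapping" "HOL-Library.Cardinality" "HOL-Library.Function_Algebras" Complex_Main
begin

section \<open>The polynomial ring, monomials and ideals\<close>

text \<open>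
  The variables of \<open>S = K[x\<^sub>1, \<dots>, x\<^sub>n]\<close> are indexed by a finite type \<open>'n\<close>, so \<open>n = CARD('n)\<close>.
  An exponent vector is an element of \<open>'n \<Rightarrow>\<^sub>0 nat\<close>, and a polynomial maps exponent vectors to
  coefficients; the product of polynomials is the convolution product of \<^theory>\<open>HOL-Library.Poly_Mapping\<close>.
\<close>

type_synonym 'n expo = "'n \<Rightarrow>\<^sub>0 nat"
type_synonym ('n, 'k) mpoly = "('n \<Rightarrow>\<^sub>0 nat) \<Rightarrow>\<^sub>0 'k"

definition Const :: "'k::zero \<Rightarrow> ('n, 'k) mpoly"
  where "Const c = Poly_Mapping.single 0 c"

definition mon :: "'n expo \<Rightarrow> ('n, 'k::zero_neq_one) mpoly"
  where "mon u = Poly_Mapping.single u 1"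

definition Var :: "'n \<Rightarrow> ('n, 'k::zero_neq_one) mpoly"
  where "Var i = mon (Poly_Mapping.single i 1)"

definition supp :: "'n expo \<Rightarrow> 'n set"
  where "supp u = Poly_Mapping.keys u"

definition mdeg :: "'n expo \<Rightarrow> nat"
  where "mdeg u = (\<Sum>i\<in>supp u. Poly_Mapping.lookup u i)"

text \<open>The zero polynomial is homogeneous of every degree, also of negative degrees.\<close>

definition homogeneous_deg :: "int \<Rightarrow> ('n, 'k::zero) mpoly \<Rightarrow> bool"
  where "homogeneous_deg e f \<longleftrightarrow> (\<forall>u\<in>Poly_Mapping.keys f. int (mdeg u) = e)"

definition homogeneous :: "('n, 'k::zero) mpoly \<Rightarrow> bool"
  where "homogeneous f \<longleftrightarrow> (\<exists>e. homogeneous_deg e f)"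

definition ideal_gen :: "('n, 'k::comm_ring_1) mpoly set \<Rightarrow> ('n, 'k) mpoly set"
  where "ideal_gen B = module.span (*) B"

definition min_num_gens :: "('n, 'k::comm_ring_1) mpoly set \<Rightarrow> nat"
  where "min_num_gens I = (LEAST m. \<exists>B. finite B \<and> card B = m \<and> ideal_gen B = I)"


section \<open>Monomial ideals\<close>

definition monomial_ideal :: "('n, 'k::comm_ring_1) mpoly set \<Rightarrow> bool"
  where "monomial_ideal I \<longleftrightarrow> (\<exists>A. I = ideal_gen (mon ` A))"

text \<open>
  The minimal monomial generating set \<open>\<G>(I)\<close> is unique for a monomial ideal;
  it is given here by its set of exponent vectors.
\<close>

definition is_min_mon_gens :: "'n expo set \<Rightarrow> ('n, 'k::comm_ring_1) mpoly set \<Rightarrow> bool"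
  where "is_min_mon_gens A I \<longleftrightarrow>
    ideal_gen (mon ` A) = I \<and> (\<forall>A'. A' \<subset> A \<longrightarrow> ideal_gen (mon ` A') \<noteq> I)"

definition min_mon_gens :: "('n, 'k::comm_ring_1) mpoly set \<Rightarrow> 'n expo set"
  where "min_mon_gens I = (THE A. is_min_mon_gens A I)"

definition squarefree_monomial_ideal :: "('n, 'k::comm_ring_1) mpoly set \<Rightarrow> bool"
  where "squarefree_monomial_ideal I \<longleftrightarrow>
    monomial_ideal I \<and> (\<forall>u\<in>min_mon_gens I. \<forall>i. Poly_Mapping.lookup u i \<le> 1)"

definition generated_in_degree :: "('n, 'k::comm_ring_1) mpoly set \<Rightarrow> nat \<Rightarrow> bool"
  where "generated_in_degree I d \<longleftrightarrow> I \<noteq> {0} \<and> (\<forall>u\<in>min_mon_gens I. mdeg u = d)"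


section \<open>Gradient ideals\<close>

definition partial_deriv :: "'n \<Rightarrow> ('n, 'k::comm_ring_1) mpoly \<Rightarrow> ('n, 'k) mpoly"
  where "partial_deriv i f = (\<Sum>u\<in>Poly_Mapping.keys f.
    Poly_Mapping.single (u - Poly_Mapping.single i 1)
      (of_nat (Poly_Mapping.lookup u i) * Poly_Mapping.lookup f u))"

definition min_homogeneous_gens :: "('n, 'k::comm_ring_1) mpoly set \<Rightarrow> ('n, 'k) mpoly set \<Rightarrow> bool"
  where "min_homogeneous_gens B I \<longleftrightarrow>
    (\<forall>f\<in>B. homogeneous f) \<and> ideal_gen B = I \<and> (\<forall>B'. B' \<subset> B \<longrightarrow> ideal_gen B' \<noteq> I)"

text \<open>
  For a homogeneous ideal, minimal generating sets are taken to consist of homogeneous elements.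
  The definition uses an arbitrary one of them, without preferring \<open>\<G>(I)\<close> for monomial ideals.
\<close>

definition gradient_ideal :: "('n, 'k::comm_ring_1) mpoly set \<Rightarrow> ('n, 'k) mpoly set"
  where "gradient_ideal I =
    ideal_gen {partial_deriv i f | i f. f \<in> (SOME B. min_homogeneous_gens B I)}"

definition gradient_by_monomials :: "('n, 'k::comm_ring_1) mpoly set \<Rightarrow> bool"
  where "gradient_by_monomials I \<longleftrightarrow>
    gradient_ideal I =
      ideal_gen {mon (u - Poly_Mapping.single i 1) | u i. u \<in> min_mon_gens I \<and> i \<in> supp u}"


section \<open>Vertex splittable ideals\<close>

text \<open>
  \<open>vertex_splittable_in V I\<close> says that \<open>I\<close> is (the extension to \<open>S\<close> of) a vertex splittable ideal of
  the polynomial ring in the variables in \<open>V\<close>. In the recursive step, \<open>I\<^sub>2\<close> lives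
  in the ring without the variable \<open>x\<^sub>i\<close>.
\<close>

inductive vertex_splittable_in :: "'n set \<Rightarrow> ('n, 'k::comm_ring_1) mpoly set \<Rightarrow> bool"
  where
    principal: "supp u \<subseteq> V \<Longrightarrow> vertex_splittable_in V (ideal_gen {mon u})"
  | zero: "vertex_splittable_in V {0}"
  | unit: "vertex_splittable_in V UNIV"
  | split: "\<lbrakk>i \<in> V; vertex_splittable_in V I1; vertex_splittable_in (V - {i}) I2;
      xI1 = {Var i * f | f. f \<in> I1};
      I = {f + g | f g. f \<in> xI1 \<and> g \<in> I2}; I2 \<subseteq> I1;
      min_mon_gens I = min_mon_gens xI1 \<union> min_mon_gens I2;
      min_mon_gens xI1 \<inter> min_mon_gens I2 = {}\<rbrakk>
      \<Longrightarrow> vertex_splittable_in V I"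

definition vertex_splittable :: "('n, 'k::comm_ring_1) mpoly set \<Rightarrow> bool"
  where "vertex_splittable I \<longleftrightarrow> vertex_splittable_in UNIV I"


section \<open>Graded free resolutions of the residue field\<close>

text \<open>
  The free module in homological degree \<open>i\<close> is \<open>F\<^sub>i = \<Oplus>\<^sub>k S(- shift F i k)\<close>, \<open>k < rank F i\<close>,
  with elements written as functions \<open>nat \<Rightarrow> S\<close> vanishing from \<open>rank F i\<close> on.
  The map \<open>F\<^sub>i\<^sub>+\<^sub>1 \<rightarrow> F\<^sub>i\<close> has the matrix \<open>diff F i\<close> (first index: row), and the augmentation
  \<open>F\<^sub>0 \<rightarrow> K = S/(x\<^sub>1, \<dots>, x\<^sub>n)\<close> sends the \<open>k\<close>-th basis element to \<open>aug F k\<close>.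
\<close>

record (overloaded) ('n, 'k) free_complex =
  rank :: "nat \<Rightarrow> nat"
  shift :: "nat \<Rightarrow> nat \<Rightarrow> int"
  diff :: "nat \<Rightarrow> nat \<Rightarrow> nat \<Rightarrow> ('n, 'k) mpoly"
  aug :: "nat \<Rightarrow> 'k"

text \<open>For an ideal \<open>I\<close>, the module \<open>F\<^sub>i \<otimes> I\<close> is identified with \<open>I\<close>-valued vectors of length \<open>rank F i\<close>.\<close>

definition tensor_vecs ::
  "('n, 'k::comm_ring_1) free_complex \<Rightarrow> ('n, 'k) mpoly set \<Rightarrow> nat \<Rightarrow> (nat \<Rightarrow> ('n, 'k) mpoly) set"
  where "tensor_vecs F I i = {v. (\<forall>k<rank F i. v k \<in> I) \<and> (\<forall>k\<ge>rank F i. v k = 0)}"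

definition diff_map ::
  "('n, 'k::comm_ring_1) free_complex \<Rightarrow> nat \<Rightarrow> (nat \<Rightarrow> ('n, 'k) mpoly) \<Rightarrow> (nat \<Rightarrow> ('n, 'k) mpoly)"
  where "diff_map F i v =
    (\<lambda>r. if r < rank F i then \<Sum>c<rank F (Suc i). diff F i r c * v c else 0)"

fun cycles ::
  "('n, 'k::comm_ring_1) free_complex \<Rightarrow> ('n, 'k) mpoly set \<Rightarrow> nat \<Rightarrow> (nat \<Rightarrow> ('n, 'k) mpoly) set"
  where
    "cycles F I 0 = tensor_vecs F I 0"
  | "cycles F I (Suc i) = {v \<in> tensor_vecs F I (Suc i). diff_map F i v = (\<lambda>_. 0)}"

definition boundaries ::
  "('n, 'k::comm_ring_1) free_complex \<Rightarrow> ('n, 'k) mpoly set \<Rightarrow> nat \<Rightarrow> (nat \<Rightarrow> ('n, 'k) mpoly) set"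
  where "boundaries F I i = diff_map F i ` tensor_vecs F I (Suc i)"

definition degree_part :: "('n, 'k::zero) free_complex \<Rightarrow> nat \<Rightarrow> int \<Rightarrow> (nat \<Rightarrow> ('n, 'k) mpoly) set"
  where "degree_part F i j = {v. \<forall>k<rank F i. homogeneous_deg (j - shift F i k) (v k)}"

definition graded_free_resolution_of_K :: "('n, 'k::comm_ring_1) free_complex \<Rightarrow> bool"
  where "graded_free_resolution_of_K F \<longleftrightarrow>
    (\<forall>i. \<forall>r<rank F i. \<forall>c<rank F (Suc i).
      homogeneous_deg (shift F (Suc i) c - shift F i r) (diff F i r c)) \<and>
    (\<forall>k<rank F 0. aug F k \<noteq> 0 \<longrightarrow> shift F 0 k = 0) \<and>
    (\<forall>a. \<exists>v\<in>tensor_vecs F UNIV 0. (\<Sum>k<rank F 0. Poly_Mapping.lookup (v k) 0 * aug F k) = a) \<and>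
    {v \<in> tensor_vecs F UNIV 0. (\<Sum>k<rank F 0. Poly_Mapping.lookup (v k) 0 * aug F k) = 0}
      = boundaries F UNIV 0 \<and>
    (\<forall>i. cycles F UNIV (Suc i) = boundaries F UNIV (Suc i))"


section \<open>Tor and Castelnuovo--Mumford regularity\<close>

definition vec_scale :: "'k::comm_ring_1 \<Rightarrow> (nat \<Rightarrow> ('n, 'k) mpoly) \<Rightarrow> (nat \<Rightarrow> ('n, 'k) mpoly)"
  where "vec_scale a v = (\<lambda>k. Const a * v k)"

text \<open>
  \<open>Tor\<^sub>i(K, I) = H\<^sub>i(F \<otimes> I)\<close> for a graded free resolution \<open>F\<close> of \<open>K\<close>; up to isomorphism it does not
  depend on \<open>F\<close>. Since the ranks are finite, the degree parts of cycles and boundaries are finite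
  dimensional over \<open>K\<close>, and the dimension of their quotient is the difference of their dimensions.
\<close>

definition dim_Tor :: "nat \<Rightarrow> ('n, 'k::field) mpoly set \<Rightarrow> int \<Rightarrow> nat"
  where "dim_Tor i I j = (let F = (SOME F. graded_free_resolution_of_K F) in
    vector_space.dim vec_scale (cycles F I i \<inter> degree_part F i j)
    - vector_space.dim vec_scale (boundaries F I i \<inter> degree_part F i j))"

definition reg :: "('n, 'k::field) mpoly set \<Rightarrow> int"
  where "reg I = Max {j - int i | i j. dim_Tor i I j \<noteq> 0}"

end

theory Submission
  imports Defs
begin

text \<open>
  Squarefree monomial ideals generated in degree \<open>d\<close> correspond to families \<open>X\<close> of \<open>d\<close>-subsets of the set of
  variables, and the gradient ideal corresponds to the shadow of \<open>X\<close>, the family of all sets obtained by removing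
  one element from a member (\<open>gradient_sqfree_ideal\<close>). The lower bound on \<open>\<mu>(I)\<close> says that at most
  \<open>2d - 1\<close> of the \<open>d\<close>-subsets are missing from \<open>X\<close>. If \<open>n \<ge> 2d\<close>, then this property is inherited by the shadow: a missing
  \<open>(d-1)\<close>-set forces all its \<open>n - d + 1\<close> supersets of size \<open>d\<close> to be missing from \<open>X\<close>, and two missing
  sets would force at least \<open>2(n - d + 1) - 1 > 2d - 1\<close> of them (\<open>card_missing_shadow\<close>). So all iterated gradient ideals
  with \<open>l \<le> d\<close> arise from families with few missing sets.

  Such a family, if it has at least two members, has a vertex whose link and deletion are again families with few missing sets, with the
  deletion contained in the ideal of the link (\<open>exists_splitting_vertex\<close>). This gives vertex
  splittability by induction on the number of variables (\<open>vertex_splittable_in_few_missing\<close>).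

  For the regularity, a vertex splittable ideal with all generators in degree \<open>e\<close> is shown to have a linear
  resolution (\<open>vertex_splittable_in_linear_homology\<close>). In a splitting \<open>I = x\<^sub>i I\<^sub>1 + I\<^sub>2\<close>, the intersection of
  the two summands is \<open>x\<^sub>i I\<^sub>2\<close>, and the long exact sequence of \<open>Tor\<close> gives the claim for \<open>I\<close> from those for
  \<open>x\<^sub>i I\<^sub>1\<close>, \<open>I\<^sub>2\<close> and \<open>x\<^sub>i I\<^sub>2\<close>. The chase works in \<open>F \<otimes> I\<close> for every graded free resolution \<open>F\<close> of \<open>K\<close>, as it
  must, because \<open>Tor\<close> is computed from an unspecified one. That a resolution exists is proved by iterated mapping cones, which build the Koszul
  complex one variable at a time (\<open>graded_free_resolution_of_K_exists\<close>). Since \<open>Tor\<^sub>0(K, I)\<^sub>e\<close> does not vanish, \<open>reg I = e\<close>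
  (\<open>reg_linear\<close>).
\<close>

section \<open>Exponent vectors and spans of monomials\<close>

lemma mdeg_eq_sum:
  assumes "finite S" "supp u \<subseteq> S"
  shows "mdeg u = (\<Sum>i\<in>S. Poly_Mapping.lookup u i)"
  unfolding mdeg_def using assms
  by (intro sum.mono_neutral_left) (auto simp: supp_def in_keys_iff)

lemma finite_supp [simp]: "finite (supp u)"
  by (simp add: supp_def)

lemma supp_add: "supp (u + v) = supp u \<union> supp v"
  by (auto simp: supp_def in_keys_iff lookup_add)

lemma mdeg_add: "mdeg (u + v) = mdeg u + mdeg v"
proof -
  let ?S = "supp u \<union> supp v"
  have "mdeg (u + v) = (\<Sum>i\<in>?S. Poly_Mapping.lookup (u + v) i)"
    by (rule mdeg_eq_sum) (auto simp: supp_add)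
  also have "\<dots> = mdeg u + mdeg v"
    by (simp add: mdeg_eq_sum[of ?S u] mdeg_eq_sum[of ?S v] lookup_add sum.distrib)
  finally show ?thesis .
qed

lemma mdeg_eq_0_iff [simp]: "mdeg u = 0 \<longleftrightarrow> u = 0"
  by (auto simp: mdeg_def supp_def in_keys_iff poly_mapping_eq_iff fun_eq_iff)

lemma mdeg_0 [simp]: "mdeg 0 = 0"
  by (simp add: mdeg_def)

lemma mdeg_single [simp]: "mdeg (Poly_Mapping.single i k) = k"
  by (cases "k = 0") (auto simp: mdeg_def supp_def)

lemma add_single_diff:
  fixes u :: "'n expo"
  assumes "i \<in> supp u"
  shows "Poly_Mapping.single i 1 + (u - Poly_Mapping.single i 1) = u"
  using assms
  by (intro poly_mapping_eqI)
     (auto simp: lookup_add lookup_minus lookup_single when_def supp_def in_keys_iff)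

text \<open>The \<open>K\<close>-span of the monomials with exponents in \<open>U\<close>. Monomial ideals are exactly these spans for
  sets \<open>U\<close> closed under multiples, and in this form sums and intersections of monomial ideals
  become unions and intersections of sets.\<close>

definition mon_span :: "'n expo set \<Rightarrow> ('n, 'k::zero) mpoly set"
  where "mon_span U = {f. Poly_Mapping.keys f \<subseteq> U}"

definition multiples :: "'n expo set \<Rightarrow> 'n expo set"
  where "multiples A = {a + v | a v. a \<in> A}"

lemma mon_spanI: "Poly_Mapping.keys f \<subseteq> U \<Longrightarrow> f \<in> mon_span U"
  and mon_spanD: "f \<in> mon_span U \<Longrightarrow> Poly_Mapping.keys f \<subseteq> U"
  by (auto simp: mon_span_def)

lemma zero_in_mon_span [simp]: "0 \<in> mon_span U"
  by (simp add: mon_span_def)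

lemma mon_span_add: "f \<in> mon_span U \<Longrightarrow> g \<in> mon_span U \<Longrightarrow> f + g \<in> mon_span U"
  using keys_add[of f g] by (auto simp: mon_span_def)

lemma mon_span_uminus:
  fixes f :: "('n, 'k::ab_group_add) mpoly"
  shows "f \<in> mon_span U \<Longrightarrow> - f \<in> mon_span U"
  by (auto simp: mon_span_def in_keys_iff subset_iff)

lemma mon_span_diff:
  fixes f g :: "('n, 'k::ab_group_add) mpoly"
  shows "f \<in> mon_span U \<Longrightarrow> g \<in> mon_span U \<Longrightarrow> f - g \<in> mon_span U"
  using mon_span_add[of f U "- g"] mon_span_uminus[of g U] by simp

lemma mon_span_sum: "(\<And>x. x \<in> X \<Longrightarrow> f x \<in> mon_span U) \<Longrightarrow> sum f X \<in> mon_span U"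
  by (induction X rule: infinite_finite_induct) (auto intro: mon_span_add)

lemma single_in_mon_span: "u \<in> U \<Longrightarrow> Poly_Mapping.single u c \<in> mon_span U"
  by (simp add: mon_span_def)

lemma mon_in_mon_span [simp]: "(mon u :: ('n, 'k::zero_neq_one) mpoly) \<in> mon_span U \<longleftrightarrow> u \<in> U"
  by (simp add: mon_span_def mon_def)

lemma mon_span_mono: "U \<subseteq> W \<Longrightarrow> mon_span U \<subseteq> mon_span W"
  by (auto simp: mon_span_def)

lemma mon_span_subset_iff:
  "(mon_span U :: ('n, 'k::zero_neq_one) mpoly set) \<subseteq> mon_span W \<longleftrightarrow> U \<subseteq> W"
proof
  assume *: "(mon_span U :: ('n, 'k) mpoly set) \<subseteq> mon_span W"
  show "U \<subseteq> W"
  proof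
    fix u assume "u \<in> U"
    then have "(mon u :: ('n, 'k) mpoly) \<in> mon_span U" by simp
    then show "u \<in> W" using * by (metis mon_in_mon_span subsetD)
  qed
qed (rule mon_span_mono)

lemma mon_span_eq_iff:
  "(mon_span U :: ('n, 'k::zero_neq_one) mpoly set) = mon_span W \<longleftrightarrow> U = W"
  using mon_span_subset_iff by (metis set_eq_subset)

lemma mon_span_empty [simp]: "mon_span {} = {0}"
  by (auto simp: mon_span_def)

lemma mon_span_UNIV [simp]: "mon_span UNIV = UNIV"
  by (auto simp: mon_span_def)

lemma multiplesI: "a \<in> A \<Longrightarrow> a + v \<in> multiples A"
  by (auto simp: multiples_def)

lemma multiplesE:
  assumes "u \<in> multiples A" obtains a v where "a \<in> A" "u = a + v"
  using assms by (auto simp: multiples_def)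

lemma subset_multiples: "A \<subseteq> multiples A"
  using multiplesI[of _ A 0] by auto

lemma multiples_add: "u \<in> multiples A \<Longrightarrow> u + v \<in> multiples A"
  by (auto elim!: multiplesE simp: add.assoc intro: multiplesI)

lemma multiples_subset_iff: "multiples A \<subseteq> multiples B \<longleftrightarrow> A \<subseteq> multiples B"
proof
  assume "multiples A \<subseteq> multiples B"
  then show "A \<subseteq> multiples B" using subset_multiples[of A] by (rule subset_trans[rotated])
next
  assume "A \<subseteq> multiples B"
  then show "multiples A \<subseteq> multiples B" by (auto elim!: multiplesE[of _ A] intro: multiples_add)
qed

lemma multiples_idem [simp]: "multiples (multiples A) = multiples A"
  by (rule subset_antisym) (simp add: multiples_subset_iff, rule subset_multiples)

lemma multiples_empty [simp]: "multiples {} = {}"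
  by (simp add: multiples_def)

lemma multiples_Un: "multiples (A \<union> B) = multiples A \<union> multiples B"
  by (auto simp: multiples_def)

lemma multiples_translate: "multiples ((+) x ` U) = (+) x ` multiples U"
proof
  show "multiples ((+) x ` U) \<subseteq> (+) x ` multiples U"
    by (auto elim!: multiplesE simp: add.assoc intro!: imageI multiplesI)
  show "(+) x ` multiples U \<subseteq> multiples ((+) x ` U)"
    by (auto elim!: multiplesE simp flip: add.assoc intro!: multiplesI[OF imageI])
qed

lemma poly_mapping_eq_sum_single:
  "f = (\<Sum>u\<in>Poly_Mapping.keys f. Poly_Mapping.single u (Poly_Mapping.lookup f u))"
  by (rule poly_mapping_eqI)
     (auto simp: lookup_sum lookup_single when_def sum.delta in_keys_iff)

lemma mon_span_mult:
  assumes "g \<in> mon_span U" "multiples U = U"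
  shows "f * g \<in> mon_span U"
proof (rule mon_spanI, rule subsetI)
  fix w assume "w \<in> Poly_Mapping.keys (f * g)"
  then obtain a b where "w = a + b" "b \<in> Poly_Mapping.keys g" using keys_mult[of f g] by auto
  then show "w \<in> U" using multiples_add[of b U a] assms mon_spanD by (auto simp: add.commute)
qed

lemma module_times: "module ((*) :: 'a::comm_ring_1 \<Rightarrow> 'a \<Rightarrow> 'a)"
  by standard (auto simp: algebra_simps)

interpretation ideal: module "(*) :: 'a::comm_ring_1 \<Rightarrow> 'a \<Rightarrow> 'a"
  by (rule module_times)

text \<open>A multiple of a monomial has only multiples of it as terms, and conversely each such term is a
  multiple of a generator. This turns questions about monomial ideals into questions about sets
  of exponent vectors.\<close>

lemma ideal_gen_mon: "ideal_gen (mon ` A) = (mon_span (multiples A) :: ('n, 'k::comm_ring_1) mpoly set)"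
proof
  show "ideal_gen (mon ` A) \<subseteq> (mon_span (multiples A) :: ('n, 'k) mpoly set)"
    unfolding ideal_gen_def
  proof (rule ideal.span_minimal)
    show "mon ` A \<subseteq> (mon_span (multiples A) :: ('n, 'k) mpoly set)"
      using subset_multiples[of A] by auto
    show "ideal.subspace (mon_span (multiples A) :: ('n, 'k) mpoly set)"
      by (auto simp: ideal.subspace_def intro: mon_span_add mon_span_mult)
  qed
  show "(mon_span (multiples A) :: ('n, 'k) mpoly set) \<subseteq> ideal_gen (mon ` A)"
  proof
    fix f :: "('n, 'k) mpoly" assume f: "f \<in> mon_span (multiples A)"
    have "Poly_Mapping.single u (Poly_Mapping.lookup f u) \<in> ideal_gen (mon ` A)"
      if "u \<in> Poly_Mapping.keys f" for u
    proof -
      have "u \<in> multiples A" using that mon_spanD[OF f] by auto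
      then obtain a v where "a \<in> A" "u = a + v" by (rule multiplesE)
      then have "Poly_Mapping.single u (Poly_Mapping.lookup f u)
          = Poly_Mapping.single v (Poly_Mapping.lookup f u) * mon a"
        by (simp add: mon_def mult_single add.commute)
      then show ?thesis using \<open>a \<in> A\<close> unfolding ideal_gen_def
        by (metis ideal.span_base ideal.span_scale imageI)
    qed
    then have "(\<Sum>u\<in>Poly_Mapping.keys f. Poly_Mapping.single u (Poly_Mapping.lookup f u))
        \<in> ideal_gen (mon ` A)"
      unfolding ideal_gen_def by (rule ideal.span_sum)
    then show "f \<in> ideal_gen (mon ` A)" using poly_mapping_eq_sum_single[of f] by simp
  qed
qed

lemma ideal_gen_singleton_mon:
  "ideal_gen {mon u} = (mon_span (multiples {u}) :: ('n, 'k::comm_ring_1) mpoly set)"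
  using ideal_gen_mon[of "{u}"] by simp

section \<open>Minimal monomial generators\<close>

definition min_exps :: "'n expo set \<Rightarrow> 'n expo set"
  where "min_exps U = {u \<in> U. \<forall>a\<in>U. \<forall>v. u = a + v \<longrightarrow> v = 0}"

text \<open>Passing to a proper divisor lowers the degree, so every exponent vector in \<open>U\<close> lies above a minimal
  one.\<close>

lemma multiples_min_exps: "multiples (min_exps U) = multiples U"
proof
  show "multiples (min_exps U) \<subseteq> multiples U"
    by (auto simp: multiples_def min_exps_def)
  have "u \<in> U \<Longrightarrow> u \<in> multiples (min_exps U)" for u
  proof (induction "mdeg u" arbitrary: u rule: less_induct)
    case less
    show ?case
    proof (cases "u \<in> min_exps U")
      case True then show ?thesis using subset_multiples by blast
    next
      case False
      then obtain a v where av: "a \<in> U" "u = a + v" "v \<noteq> 0" using less.prems by (auto simp: min_exps_def)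
      then have "mdeg a < mdeg u" by (metis mdeg_add mdeg_eq_0_iff less_add_same_cancel1 gr0I)
      then show ?thesis using less.hyps av multiples_add by blast
    qed
  qed
  then show "multiples U \<subseteq> multiples (min_exps U)" by (subst multiples_subset_iff) blast
qed

text \<open>A generator that divides a minimal exponent vector is equal to it, so every generating set of
  monomials contains the minimal ones, which already generate. Hence exactly one set satisfies the
  description of \<open>\<G>(I)\<close>.\<close>

lemma min_mon_gens_mon_span:
  "min_mon_gens (mon_span (multiples A) :: ('n, 'k::comm_ring_1) mpoly set) = min_exps (multiples A)"
proof -
  let ?U = "multiples A"
  let ?I = "mon_span ?U :: ('n, 'k) mpoly set"
  have gen_iff: "ideal_gen (mon ` B) = ?I \<longleftrightarrow> multiples B = ?U" for B
    by (simp add: ideal_gen_mon mon_span_eq_iff)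
  have le: "min_exps ?U \<subseteq> B" if "multiples B = ?U" for B
  proof
    fix u assume u: "u \<in> min_exps ?U"
    then have "u \<in> multiples B" using that by (simp add: min_exps_def)
    then obtain b v where "b \<in> B" "u = b + v" by (rule multiplesE)
    then show "u \<in> B" using u that subset_multiples[of B] by (fastforce simp: min_exps_def)
  qed
  have gen: "multiples (min_exps ?U) = ?U" by (simp add: multiples_min_exps)
  have "is_min_mon_gens B ?I \<longleftrightarrow> B = min_exps ?U" for B
    unfolding is_min_mon_gens_def gen_iff using le gen by blast
  then show ?thesis by (simp add: min_mon_gens_def)
qed

lemma min_exps_multiples_antichain:
  assumes "\<And>a b v. a \<in> A \<Longrightarrow> b \<in> A \<Longrightarrow> b = a + v \<Longrightarrow> v = 0"
  shows "min_exps (multiples A) = A"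
proof -
  have "u \<in> A" if u: "u \<in> min_exps (multiples A)" for u
  proof -
    have "u \<in> multiples A" using u by (simp add: min_exps_def)
    then obtain a v where "a \<in> A" "u = a + v" by (rule multiplesE)
    then show ?thesis using u subset_multiples[of A] by (fastforce simp: min_exps_def)
  qed
  moreover have "u \<in> min_exps (multiples A)" if u: "u \<in> A" for u
  proof -
    have "v = 0" if "b \<in> multiples A" "u = b + v" for b v
    proof -
      obtain a w where a: "a \<in> A" "b = a + w" using \<open>b \<in> multiples A\<close> by (auto elim: multiplesE)
      then have "w + v = 0" using assms[of a u "w + v"] u that by (simp add: add.assoc)
      then show "v = 0" by (metis mdeg_add mdeg_eq_0_iff add_is_0)
    qed
    then show ?thesis using u subset_multiples[of A] by (auto simp: min_exps_def)
  qed
  ultimately show ?thesis by blast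
qed

lemma min_exps_multiples_equal_degree:
  assumes "\<And>a. a \<in> A \<Longrightarrow> mdeg a = e"
  shows "min_exps (multiples A) = A"
proof (rule min_exps_multiples_antichain)
  fix a b v assume "a \<in> A" "b \<in> A" "b = a + v"
  then have "mdeg v = 0" using assms mdeg_add[of a v] by auto
  then show "v = 0" by simp
qed

lemma min_exps_translate: "min_exps ((+) x ` U) = (+) x ` min_exps U"
  by (auto simp: min_exps_def add.assoc image_iff)

lemma min_mon_gens_ideal_gen:
  assumes "\<And>a. a \<in> A \<Longrightarrow> mdeg a = e"
  shows "min_mon_gens (ideal_gen (mon ` A) :: ('n, 'k::comm_ring_1) mpoly set) = A"
  by (simp add: ideal_gen_mon min_mon_gens_mon_span min_exps_multiples_equal_degree[OF assms])

lemma monomial_ideal_eq_mon_span: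
  assumes "monomial_ideal I"
  shows "I = mon_span (multiples (min_mon_gens I))"
proof -
  obtain A where "I = mon_span (multiples A)" using assms by (auto simp: monomial_ideal_def ideal_gen_mon)
  then show ?thesis by (simp add: min_mon_gens_mon_span multiples_min_exps)
qed

section \<open>Homogeneous components and multiplication by a monomial\<close>

text \<open>The projection onto \<open>mon_span U\<close> that forgets the terms outside \<open>U\<close>; \<open>hcomp j\<close> below is the
  homogeneous component of degree \<open>j\<close>.\<close>

definition restr :: "'a set \<Rightarrow> ('a \<Rightarrow>\<^sub>0 'b::comm_monoid_add) \<Rightarrow> ('a \<Rightarrow>\<^sub>0 'b)"
  where "restr U f = (\<Sum>u\<in>Poly_Mapping.keys f \<inter> U. Poly_Mapping.single u (Poly_Mapping.lookup f u))"

lemma lookup_restr: "Poly_Mapping.lookup (restr U f) u = (if u \<in> U then Poly_Mapping.lookup f u else 0)"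
  by (auto simp: restr_def lookup_sum lookup_single when_def sum.delta in_keys_iff)

lemma keys_restr: "Poly_Mapping.keys (restr U f) = Poly_Mapping.keys f \<inter> U"
  by (auto simp: in_keys_iff lookup_restr split: if_splits)

lemma restr_add: "restr U (f + g) = restr U f + restr U g"
  by (rule poly_mapping_eqI) (simp add: lookup_restr lookup_add)

lemma restr_0 [simp]: "restr U 0 = 0"
  by (rule poly_mapping_eqI) (simp add: lookup_restr)

lemma restr_sum: "restr U (sum f X) = (\<Sum>x\<in>X. restr U (f x))"
  by (induction X rule: infinite_finite_induct) (auto simp: restr_add)

lemma restr_id: "Poly_Mapping.keys f \<subseteq> U \<Longrightarrow> restr U f = f"
  by (rule poly_mapping_eqI) (auto simp: lookup_restr in_keys_iff subset_iff)

lemma restr_eq_0: "Poly_Mapping.keys f \<inter> U = {} \<Longrightarrow> restr U f = 0"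
  by (rule poly_mapping_eqI) (auto simp: lookup_restr in_keys_iff)

lemma restr_add_compl: "restr U f + restr (- U) f = f"
  by (rule poly_mapping_eqI) (simp add: lookup_restr lookup_add)

definition hcomp :: "int \<Rightarrow> ('n, 'k::comm_monoid_add) mpoly \<Rightarrow> ('n, 'k) mpoly"
  where "hcomp j = restr {u. int (mdeg u) = j}"

lemma homogeneous_deg_iff: "homogeneous_deg e f \<longleftrightarrow> f \<in> mon_span {u. int (mdeg u) = e}"
  by (auto simp: homogeneous_deg_def mon_span_def)

lemma homogeneous_deg_hcomp: "homogeneous_deg j (hcomp j f)"
  by (auto simp: homogeneous_deg_def hcomp_def keys_restr)

lemma hcomp_id: "homogeneous_deg j f \<Longrightarrow> hcomp j f = f"
  unfolding hcomp_def by (rule restr_id) (auto simp: homogeneous_deg_def)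

lemma hcomp_mon_span: "f \<in> mon_span U \<Longrightarrow> hcomp j f \<in> mon_span U"
  by (auto simp: mon_span_def hcomp_def keys_restr)

lemma hcomp_mult:
  fixes D f :: "('n, 'k::comm_ring_1) mpoly"
  assumes "homogeneous_deg s D"
  shows "hcomp j (D * f) = D * hcomp (j - s) f"
proof -
  let ?U = "{u. int (mdeg u) = j - s}"
  have "D * f = D * restr ?U f + D * restr (- ?U) f"
    by (simp flip: distrib_left add: restr_add_compl)
  moreover have "hcomp j (D * restr ?U f) = D * restr ?U f"
  proof (rule hcomp_id)
    show "homogeneous_deg j (D * restr ?U f)"
      unfolding homogeneous_deg_def using assms keys_mult[of D "restr ?U f"]
      by (fastforce simp: homogeneous_deg_def keys_restr mdeg_add)
  qed
  moreover have "hcomp j (D * restr (- ?U) f) = 0"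
    unfolding hcomp_def
  proof (rule restr_eq_0, rule ccontr)
    assume "Poly_Mapping.keys (D * restr (- ?U) f) \<inter> {u. int (mdeg u) = j} \<noteq> {}"
    then obtain a b where "a \<in> Poly_Mapping.keys D" "int (mdeg b) \<noteq> j - s" "int (mdeg (a + b)) = j"
      using keys_mult[of D "restr (- ?U) f"] by (fastforce simp: keys_restr)
    then show False using assms by (auto simp: homogeneous_deg_def mdeg_add)
  qed
  ultimately show ?thesis by (simp add: hcomp_def restr_add)
qed

lemma mon_mult_eq_sum:
  fixes f :: "('n, 'k::comm_ring_1) mpoly"
  shows "mon x * f = (\<Sum>u\<in>Poly_Mapping.keys f. Poly_Mapping.single (x + u) (Poly_Mapping.lookup f u))"
proof -
  have "mon x * f = mon x * (\<Sum>u\<in>Poly_Mapping.keys f. Poly_Mapping.single u (Poly_Mapping.lookup f u))"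
    using poly_mapping_eq_sum_single[of f] by simp
  then show ?thesis by (simp add: sum_distrib_left mon_def mult_single)
qed

lemma lookup_mon_mult:
  fixes f :: "('n, 'k::comm_ring_1) mpoly"
  shows "Poly_Mapping.lookup (mon x * f) (x + u) = Poly_Mapping.lookup f u"
  by (auto simp: mon_mult_eq_sum lookup_sum lookup_single when_def sum.delta in_keys_iff)

lemma keys_mon_mult:
  fixes f :: "('n, 'k::comm_ring_1) mpoly"
  shows "Poly_Mapping.keys (mon x * f) = (+) x ` Poly_Mapping.keys f"
proof
  show "Poly_Mapping.keys (mon x * f) \<subseteq> (+) x ` Poly_Mapping.keys f"
    using keys_mult[of "mon x" f] by (auto simp: mon_def)
  show "(+) x ` Poly_Mapping.keys f \<subseteq> Poly_Mapping.keys (mon x * f)"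
    by (auto simp: in_keys_iff lookup_mon_mult)
qed

lemma mon_mult_eq_0:
  fixes f :: "('n, 'k::comm_ring_1) mpoly"
  shows "mon x * f = 0 \<Longrightarrow> f = 0"
  using keys_mon_mult[of x f] by (metis image_is_empty keys_zero mon_spanI mon_span_empty order_refl singletonD)

lemma mon_span_translate:
  "mon_span ((+) x ` U) = {mon x * f | f. f \<in> (mon_span U :: ('n, 'k::comm_ring_1) mpoly set)}"
proof (intro set_eqI iffI)
  fix g :: "('n, 'k) mpoly" assume g: "g \<in> mon_span ((+) x ` U)"
  define f where "f = (\<Sum>u\<in>Poly_Mapping.keys g. Poly_Mapping.single (u - x) (Poly_Mapping.lookup g u))"
  have "f \<in> mon_span U" unfolding f_def
    by (rule mon_span_sum, rule single_in_mon_span) (use g in \<open>auto simp: mon_span_def\<close>)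
  have "mon x * f = (\<Sum>u\<in>Poly_Mapping.keys g. Poly_Mapping.single (x + (u - x)) (Poly_Mapping.lookup g u))"
    by (simp add: f_def sum_distrib_left mon_def mult_single)
  also have "\<dots> = (\<Sum>u\<in>Poly_Mapping.keys g. Poly_Mapping.single u (Poly_Mapping.lookup g u))"
    by (rule sum.cong) (use g in \<open>auto simp: mon_span_def\<close>)
  finally show "g \<in> {mon x * f | f. f \<in> (mon_span U :: ('n, 'k) mpoly set)}"
    using \<open>f \<in> mon_span U\<close> poly_mapping_eq_sum_single[of g] by auto
next
  fix g :: "('n, 'k) mpoly" assume "g \<in> {mon x * f | f. f \<in> mon_span U}"
  then show "g \<in> mon_span ((+) x ` U)" by (force simp: mon_span_def keys_mon_mult)
qed

section \<open>Tor of sums and multiples of monomial ideals\<close>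

lemma diff_map_add: "diff_map F i (v + w) = diff_map F i v + diff_map F i w"
  by (rule ext) (simp add: diff_map_def distrib_left sum.distrib)

lemma diff_map_uminus: "diff_map F i (- v) = - diff_map F i v"
  by (rule ext) (simp add: diff_map_def sum_negf)

lemma diff_map_diff: "diff_map F i (v - w) = diff_map F i v - diff_map F i w"
  using diff_map_add[of F i v "- w"] by (simp add: diff_map_uminus)

lemma diff_map_scale: "diff_map F i (\<lambda>k. a * v k) = (\<lambda>k. a * diff_map F i v k)"
  by (rule ext) (auto simp: diff_map_def sum_distrib_left mult.left_commute intro!: sum.cong)

lemma tensor_vecs_add:
  "v \<in> tensor_vecs F (mon_span U) i \<Longrightarrow> w \<in> tensor_vecs F (mon_span U) i \<Longrightarrow>
    v + w \<in> tensor_vecs F (mon_span U) i"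
  by (auto simp: tensor_vecs_def intro: mon_span_add)

lemma tensor_vecs_diff:
  "v \<in> tensor_vecs F (mon_span U) i \<Longrightarrow> w \<in> tensor_vecs F (mon_span U) i \<Longrightarrow>
    v - w \<in> tensor_vecs F (mon_span U) i"
  by (auto simp: tensor_vecs_def intro: mon_span_diff)

lemma tensor_vecs_uminus:
  "v \<in> tensor_vecs F (mon_span U) i \<Longrightarrow> - v \<in> tensor_vecs F (mon_span U) i"
  by (auto simp: tensor_vecs_def intro: mon_span_uminus)

lemma tensor_vecs_mono: "I \<subseteq> J \<Longrightarrow> tensor_vecs F I i \<subseteq> tensor_vecs F J i"
  by (auto simp: tensor_vecs_def)

lemma degree_part_iff:
  "v \<in> degree_part F i j \<longleftrightarrow> (\<forall>k<rank F i. v k \<in> mon_span {u. int (mdeg u) = j - shift F i k})"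
  by (simp add: degree_part_def homogeneous_deg_iff)

lemma degree_part_add: "v \<in> degree_part F i j \<Longrightarrow> w \<in> degree_part F i j \<Longrightarrow> v + w \<in> degree_part F i j"
  by (simp add: degree_part_iff mon_span_add)

lemma degree_part_diff:
  fixes F :: "('n, 'k::comm_ring_1) free_complex"
  shows "v \<in> degree_part F i j \<Longrightarrow> w \<in> degree_part F i j \<Longrightarrow> v - w \<in> degree_part F i j"
  by (simp add: degree_part_iff mon_span_diff)

lemma diff_map_tensor_vecs:
  assumes "v \<in> tensor_vecs F (mon_span U) (Suc i)" "multiples U = U"
  shows "diff_map F i v \<in> tensor_vecs F (mon_span U) i"
  using assms by (auto simp: tensor_vecs_def diff_map_def intro!: mon_span_sum mon_span_mult)

lemma cycles_eq:
  "cycles F I i = {v \<in> tensor_vecs F I i. \<forall>i'. i = Suc i' \<longrightarrow> diff_map F i' v = 0}"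
  by (cases i) (auto simp: zero_fun_def)

lemma boundaries_add:
  assumes "v \<in> boundaries F (mon_span U) i" "w \<in> boundaries F (mon_span U) i"
  shows "v + w \<in> boundaries F (mon_span U) i"
proof -
  obtain v' w' where "v' \<in> tensor_vecs F (mon_span U) (Suc i)" "w' \<in> tensor_vecs F (mon_span U) (Suc i)"
      "v = diff_map F i v'" "w = diff_map F i w'"
    using assms by (auto simp: boundaries_def)
  then have "v + w = diff_map F i (v' + w')" "v' + w' \<in> tensor_vecs F (mon_span U) (Suc i)"
    by (auto simp: diff_map_add intro: tensor_vecs_add)
  then show ?thesis by (auto simp: boundaries_def)
qed

lemma boundaries_mono: "I \<subseteq> J \<Longrightarrow> boundaries F I i \<subseteq> boundaries F J i"
  using tensor_vecs_mono unfolding boundaries_def by (blast intro: image_mono)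

definition vec_hcomp ::
  "('n, 'k::comm_ring_1) free_complex \<Rightarrow> nat \<Rightarrow> int \<Rightarrow> (nat \<Rightarrow> ('n, 'k) mpoly) \<Rightarrow> (nat \<Rightarrow> ('n, 'k) mpoly)"
  where "vec_hcomp F i j v = (\<lambda>k. if k < rank F i then hcomp (j - shift F i k) (v k) else 0)"

text \<open>The grading condition of \<open>graded_free_resolution_of_K\<close> on its own: complexes that resolve other modules
  satisfy it too.\<close>

definition graded_diffs :: "('n, 'k::comm_ring_1) free_complex \<Rightarrow> bool"
  where "graded_diffs F \<longleftrightarrow> (\<forall>i. \<forall>r<rank F i. \<forall>c<rank F (Suc i).
      homogeneous_deg (shift F (Suc i) c - shift F i r) (diff F i r c))"

text \<open>The matrix entries are homogeneous of the degrees prescribed by the shifts, so the differential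
  respects homogeneous components; a homogeneous boundary therefore has a homogeneous preimage.\<close>

lemma diff_map_vec_hcomp:
  assumes "graded_diffs F"
  shows "diff_map F i (vec_hcomp F (Suc i) j v) = vec_hcomp F i j (diff_map F i v)"
proof (rule ext)
  fix r
  show "diff_map F i (vec_hcomp F (Suc i) j v) r = vec_hcomp F i j (diff_map F i v) r"
  proof (cases "r < rank F i")
    case True
    have "hcomp (j - shift F i r) (\<Sum>c<rank F (Suc i). diff F i r c * v c)
        = (\<Sum>c<rank F (Suc i). hcomp (j - shift F i r) (diff F i r c * v c))"
      by (simp add: hcomp_def restr_sum)
    also have "\<dots> = (\<Sum>c<rank F (Suc i). diff F i r c * hcomp (j - shift F (Suc i) c) (v c))"
    proof (rule sum.cong[OF refl])
      fix c assume "c \<in> {..<rank F (Suc i)}"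
      then have "homogeneous_deg (shift F (Suc i) c - shift F i r) (diff F i r c)"
        using assms True by (auto simp: graded_diffs_def)
      from hcomp_mult[OF this, of "j - shift F i r" "v c"]
      show "hcomp (j - shift F i r) (diff F i r c * v c) = diff F i r c * hcomp (j - shift F (Suc i) c) (v c)"
        by simp
    qed
    finally show ?thesis using True by (simp add: diff_map_def vec_hcomp_def)
  qed (simp add: diff_map_def vec_hcomp_def)
qed

lemma vec_hcomp_degree_part: "vec_hcomp F i j v \<in> degree_part F i j"
  by (auto simp: degree_part_def vec_hcomp_def homogeneous_deg_hcomp)

lemma vec_hcomp_id:
  "v \<in> degree_part F i j \<Longrightarrow> v \<in> tensor_vecs F I i \<Longrightarrow> vec_hcomp F i j v = v"
  by (rule ext) (auto simp: vec_hcomp_def degree_part_def tensor_vecs_def hcomp_id)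

lemma vec_hcomp_tensor_vecs:
  "v \<in> tensor_vecs F (mon_span U) i \<Longrightarrow> vec_hcomp F i j v \<in> tensor_vecs F (mon_span U) i"
  by (auto simp: vec_hcomp_def tensor_vecs_def hcomp_mon_span)

lemma homogeneous_boundary_preimage:
  assumes "graded_diffs F" "z \<in> boundaries F (mon_span U) i" "z \<in> degree_part F i j"
  obtains w where "w \<in> tensor_vecs F (mon_span U) (Suc i)" "w \<in> degree_part F (Suc i) j"
    "diff_map F i w = z"
proof -
  obtain w where w: "w \<in> tensor_vecs F (mon_span U) (Suc i)" "z = diff_map F i w"
    using assms by (auto simp: boundaries_def)
  have "z \<in> tensor_vecs F UNIV i" by (auto simp: w tensor_vecs_def diff_map_def)
  then have "diff_map F i (vec_hcomp F (Suc i) j w) = z"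
    using assms w by (simp add: diff_map_vec_hcomp vec_hcomp_id)
  then show ?thesis using that vec_hcomp_tensor_vecs[OF w(1)] vec_hcomp_degree_part by blast
qed

text \<open>\<open>Tor\<^sub>i(K, I)\<^sub>j = 0\<close> unless \<open>j = i + e\<close>, which says that \<open>I\<close> has a linear resolution if it is generated
  in degree \<open>e\<close>. The formulation by cycles and boundaries of \<open>F \<otimes> I\<close> is accessible to diagram chasing and
  avoids dimensions.\<close>

definition linear_homology ::
  "('n, 'k::comm_ring_1) free_complex \<Rightarrow> ('n, 'k) mpoly set \<Rightarrow> int \<Rightarrow> bool"
  where "linear_homology F I e \<longleftrightarrow>
    (\<forall>i j. j \<noteq> int i + e \<longrightarrow> cycles F I i \<inter> degree_part F i j \<subseteq> boundaries F I i)"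

lemma tensor_vecs_split:
  assumes "z \<in> tensor_vecs F (mon_span (U \<union> W)) i" "z \<in> degree_part F i j"
  obtains p q where "z = p + q" "p \<in> tensor_vecs F (mon_span U) i" "q \<in> tensor_vecs F (mon_span W) i"
    "p \<in> degree_part F i j" "q \<in> degree_part F i j"
proof
  let ?p = "\<lambda>k. restr U (z k)" and ?q = "\<lambda>k. restr (- U) (z k)"
  show "z = ?p + ?q" by (rule ext) (simp add: restr_add_compl)
  show "?p \<in> tensor_vecs F (mon_span U) i" "?q \<in> tensor_vecs F (mon_span W) i"
    using assms(1) by (auto simp: tensor_vecs_def mon_span_def keys_restr)
  show "?p \<in> degree_part F i j" "?q \<in> degree_part F i j"
    using assms(2) by (auto simp: degree_part_def homogeneous_deg_def keys_restr)
qed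

text \<open>This is the exact sequence
  \<open>Tor\<^sub>i(K, P)\<^sub>j \<oplus> Tor\<^sub>i(K, Q)\<^sub>j \<rightarrow> Tor\<^sub>i(K, P + Q)\<^sub>j \<rightarrow> Tor\<^sub>i\<^sub>-\<^sub>1(K, P \<inter> Q)\<^sub>j\<close>
  for \<open>P = mon_span U\<close> and \<open>Q = mon_span W\<close>: if \<open>j \<noteq> i + e\<close>, then also \<open>j \<noteq> (i - 1) + (e + 1)\<close>, and both outer terms vanish.\<close>

lemma linear_homology_Un:
  assumes F: "graded_diffs F" and U: "multiples U = U" and W: "multiples W = W"
    and linU: "linear_homology F (mon_span U) e" and linW: "linear_homology F (mon_span W) e"
    and linI: "linear_homology F (mon_span (U \<inter> W)) (e + 1)"
    and dd: "\<And>i v. v \<in> tensor_vecs F UNIV (Suc (Suc i)) \<Longrightarrow> diff_map F i (diff_map F (Suc i) v) = 0"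
  shows "linear_homology F (mon_span (U \<union> W)) e"
  unfolding linear_homology_def
proof (intro allI impI subsetI)
  fix i j z assume j: "j \<noteq> int i + e" and z: "z \<in> cycles F (mon_span (U \<union> W)) i \<inter> degree_part F i j"
  obtain p q where pq: "z = p + q" "p \<in> tensor_vecs F (mon_span U) i" "q \<in> tensor_vecs F (mon_span W) i"
    "p \<in> degree_part F i j" "q \<in> degree_part F i j"
    using tensor_vecs_split[of z F U W i j] z by (auto simp: cycles_eq)
  \<comment> \<open>The differentials of \<open>p\<close> and \<open>q\<close> cancel, so they lie in \<open>F \<otimes> (P \<inter> Q)\<close>, where linearity makes them the
    boundary of some \<open>w\<close>; correcting by \<open>w\<close> turns both summands of \<open>z\<close> into cycles.\<close>
  obtain w where w: "w \<in> tensor_vecs F (mon_span (U \<inter> W)) i" "w \<in> degree_part F i j"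
    "\<And>i'. i = Suc i' \<Longrightarrow> diff_map F i' w = diff_map F i' p"
  proof (cases i)
    case 0
    have "0 \<in> tensor_vecs F (mon_span (U \<inter> W)) i" "0 \<in> degree_part F i j"
      by (auto simp: tensor_vecs_def degree_part_def homogeneous_deg_def)
    then show ?thesis using that 0 by blast
  next
    case (Suc i')
    let ?y = "diff_map F i' p"
    have "?y + diff_map F i' q = 0" using z pq(1) Suc by (auto simp: cycles_eq diff_map_add)
    then have y: "?y = - diff_map F i' q" by (simp add: eq_neg_iff_add_eq_0)
    have "?y \<in> tensor_vecs F (mon_span U) i'" "?y \<in> tensor_vecs F (mon_span W) i'"
      using diff_map_tensor_vecs[of p F U i'] diff_map_tensor_vecs[of q F W i'] pq(2,3) Suc U W
      by (simp, unfold y, simp add: tensor_vecs_uminus)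
    then have yt: "?y \<in> tensor_vecs F (mon_span (U \<inter> W)) i'"
      by (auto simp: tensor_vecs_def mon_span_def)
    have "?y \<in> cycles F (mon_span (U \<inter> W)) i'"
      using yt dd pq(2) tensor_vecs_mono[of "mon_span U" UNIV F i] Suc by (auto simp: cycles_eq)
    moreover have yd: "?y \<in> degree_part F i' j"
      using pq(2,4) Suc diff_map_vec_hcomp[OF F, of i' j p] vec_hcomp_id[of p F i j]
        vec_hcomp_degree_part[of F i' j ?y] by simp
    moreover have "j \<noteq> int i' + (e + 1)" using j Suc by simp
    ultimately have "?y \<in> boundaries F (mon_span (U \<inter> W)) i'"
      using linI by (auto simp: linear_homology_def)
    then obtain w where "w \<in> tensor_vecs F (mon_span (U \<inter> W)) (Suc i')" "w \<in> degree_part F (Suc i') j"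
        "diff_map F i' w = ?y"
      using homogeneous_boundary_preimage[OF F _ yd] by blast
    then show ?thesis using that Suc by blast
  qed
  have wU: "w \<in> tensor_vecs F (mon_span U) i" and wW: "w \<in> tensor_vecs F (mon_span W) i"
    using w(1) by (auto simp: tensor_vecs_def mon_span_def)
  have "p - w \<in> cycles F (mon_span U) i"
    using pq(2) wU w(3) by (auto simp: cycles_eq diff_map_diff intro: tensor_vecs_diff)
  then have "p - w \<in> boundaries F (mon_span U) i"
    using linU j degree_part_diff[OF pq(4) w(2)] by (auto simp: linear_homology_def)
  then have p: "p - w \<in> boundaries F (mon_span (U \<union> W)) i"
    using boundaries_mono[of "mon_span U" "mon_span (U \<union> W)" F i] mon_span_mono[of U "U \<union> W"] by blast
  have "q + w \<in> cycles F (mon_span W) i"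
  proof -
    have "diff_map F i' (q + w) = 0" if "i = Suc i'" for i'
    proof -
      have "diff_map F i' (q + w) = diff_map F i' z" using w(3)[OF that] pq(1)
        by (simp add: diff_map_add add.commute)
      then show ?thesis using z that by (auto simp: cycles_eq)
    qed
    then show ?thesis using pq(3) wW by (auto simp: cycles_eq intro: tensor_vecs_add)
  qed
  then have "q + w \<in> boundaries F (mon_span W) i"
    using linW j degree_part_add[OF pq(5) w(2)] by (auto simp: linear_homology_def)
  then have q: "q + w \<in> boundaries F (mon_span (U \<union> W)) i"
    using boundaries_mono[of "mon_span W" "mon_span (U \<union> W)" F i] mon_span_mono[of W "U \<union> W"] by blast
  have "z = (p - w) + (q + w)" using pq(1) by simp
  then show "z \<in> boundaries F (mon_span (U \<union> W)) i" using boundaries_add[OF p q] by simp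
qed

text \<open>Multiplication by a monomial is injective, so it is an isomorphism from \<open>I(-deg x)\<close> onto the product ideal.\<close>

lemma linear_homology_translate:
  fixes F :: "('n, 'k::comm_ring_1) free_complex"
  assumes "linear_homology F (mon_span U) e"
  shows "linear_homology F (mon_span ((+) x ` U)) (e + int (mdeg x))"
  unfolding linear_homology_def
proof (intro allI impI subsetI)
  fix i j z assume j: "j \<noteq> int i + (e + int (mdeg x))"
    and z: "z \<in> cycles F (mon_span ((+) x ` U)) i \<inter> degree_part F i j"
  have "\<exists>f. (k < rank F i \<longrightarrow> f \<in> mon_span U \<and> z k = mon x * f) \<and> (k \<ge> rank F i \<longrightarrow> f = 0)" for k
    using z by (cases "k < rank F i") (auto simp: cycles_eq tensor_vecs_def mon_span_translate)
  then obtain y where y: "\<And>k. k < rank F i \<Longrightarrow> y k \<in> mon_span U \<and> z k = mon x * y k"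
    "\<And>k. k \<ge> rank F i \<Longrightarrow> y k = 0" by metis
  have yt: "y \<in> tensor_vecs F (mon_span U) i" using y by (auto simp: tensor_vecs_def)
  have zy: "z = (\<lambda>k. mon x * y k)"
    using y z by (intro ext) (metis (mono_tags, lifting) IntD1 cycles_eq linorder_not_le mem_Collect_eq mult_zero_right tensor_vecs_def)
  have "diff_map F i' y = 0" if "i = Suc i'" for i'
  proof -
    have "(\<lambda>k. mon x * diff_map F i' y k) = 0"
      using z that by (auto simp: cycles_eq zy diff_map_scale)
    then show ?thesis by (auto simp: fun_eq_iff intro: mon_mult_eq_0)
  qed
  then have "y \<in> cycles F (mon_span U) i" using yt by (auto simp: cycles_eq)
  moreover have "y \<in> degree_part F i (j - int (mdeg x))"
    using z by (auto simp: zy degree_part_def homogeneous_deg_def keys_mon_mult mdeg_add algebra_simps)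
  moreover have "j - int (mdeg x) \<noteq> int i + e" using j by simp
  ultimately have "y \<in> boundaries F (mon_span U) i"
    using assms unfolding linear_homology_def by blast
  then obtain w where w: "w \<in> tensor_vecs F (mon_span U) (Suc i)" "y = diff_map F i w"
    by (auto simp: boundaries_def)
  have "(\<lambda>k. mon x * w k) \<in> tensor_vecs F (mon_span ((+) x ` U)) (Suc i)"
    using w(1) by (auto simp: tensor_vecs_def mon_span_translate)
  moreover have "z = diff_map F i (\<lambda>k. mon x * w k)" by (simp add: zy w(2) diff_map_scale)
  ultimately show "z \<in> boundaries F (mon_span ((+) x ` U)) i" by (auto simp: boundaries_def)
qed

lemma graded_free_resolution_of_KD:
  assumes "graded_free_resolution_of_K F"
  shows "graded_diffs F"
    and "\<And>k. k < rank F 0 \<Longrightarrow> aug F k \<noteq> 0 \<Longrightarrow> shift F 0 k = 0"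
    and "{v \<in> tensor_vecs F UNIV 0. (\<Sum>k<rank F 0. Poly_Mapping.lookup (v k) 0 * aug F k) = 0}
      = boundaries F UNIV 0"
    and "\<And>i. cycles F UNIV (Suc i) = boundaries F UNIV (Suc i)"
    and "\<forall>a. \<exists>v\<in>tensor_vecs F UNIV 0. (\<Sum>k<rank F 0. Poly_Mapping.lookup (v k) 0 * aug F k) = a"
  using assms unfolding graded_free_resolution_of_K_def graded_diffs_def by blast+

lemma resolution_diff_diff:
  assumes "graded_free_resolution_of_K F" "v \<in> tensor_vecs F UNIV (Suc (Suc i))"
  shows "diff_map F i (diff_map F (Suc i) v) = 0"
proof -
  have "diff_map F (Suc i) v \<in> cycles F UNIV (Suc i)"
    using assms graded_free_resolution_of_KD(4)[OF assms(1)] by (auto simp: boundaries_def)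
  then show ?thesis by (auto simp: zero_fun_def)
qed

text \<open>\<open>H\<^sub>i(F \<otimes> S) = H\<^sub>i(F)\<close> is \<open>K\<close> in degree \<open>0\<close> for \<open>i = 0\<close> and zero otherwise. In homological degree \<open>0\<close>, the
  augmentation only sees constant coefficients of basis elements of shift \<open>0\<close>, so it kills all
  vectors that are homogeneous of a degree other than \<open>0\<close>.\<close>

lemma linear_homology_UNIV:
  assumes F: "graded_free_resolution_of_K F"
  shows "linear_homology F UNIV 0"
  unfolding linear_homology_def
proof (intro allI impI subsetI)
  fix i j z assume j: "j \<noteq> int i + 0" and z: "z \<in> cycles F UNIV i \<inter> degree_part F i j"
  show "z \<in> boundaries F UNIV i"
  proof (cases i)
    case (Suc i')
    then show ?thesis using z graded_free_resolution_of_KD(4)[OF F] by blast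
  next
    case 0
    have "Poly_Mapping.lookup (z k) 0 * aug F k = 0" if "k < rank F 0" for k
    proof (rule ccontr)
      assume "Poly_Mapping.lookup (z k) 0 * aug F k \<noteq> 0"
      then have "aug F k \<noteq> 0" "0 \<in> Poly_Mapping.keys (z k)" by (auto simp: in_keys_iff)
      moreover from this have "shift F 0 k = 0" using graded_free_resolution_of_KD(2)[OF F that] by blast
      ultimately have "int (mdeg (0 :: 'a expo)) = j"
        using z 0 that by (fastforce simp: degree_part_def homogeneous_deg_def)
      then show False using j 0 mdeg_eq_0_iff[of "0 :: 'a expo"] by (simp del: mdeg_eq_0_iff)
    qed
    then have "(\<Sum>k<rank F 0. Poly_Mapping.lookup (z k) 0 * aug F k) = 0" by simp
    then show ?thesis using z 0 graded_free_resolution_of_KD(3)[OF F] by auto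
  qed
qed

section \<open>Vertex splittable ideals\<close>

lemma mon_span_plus:
  "{f + g | f g. f \<in> mon_span U \<and> g \<in> mon_span W} = (mon_span (U \<union> W) :: ('n, 'k::comm_ring_1) mpoly set)"
proof
  show "{f + g | f g. f \<in> mon_span U \<and> g \<in> mon_span W} \<subseteq> (mon_span (U \<union> W) :: ('n, 'k) mpoly set)"
    using mon_span_mono[of U "U \<union> W"] mon_span_mono[of W "U \<union> W"] by (blast intro: mon_span_add)
  show "(mon_span (U \<union> W) :: ('n, 'k) mpoly set) \<subseteq> {f + g | f g. f \<in> mon_span U \<and> g \<in> mon_span W}"
  proof
    fix f :: "('n, 'k) mpoly" assume f: "f \<in> mon_span (U \<union> W)"
    have "restr U f \<in> mon_span U" "restr (- U) f \<in> mon_span W"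
      using f by (auto simp: mon_span_def keys_restr)
    then show "f \<in> {f + g | f g. f \<in> mon_span U \<and> g \<in> mon_span W}"
      using restr_add_compl[of U f] by (metis (mono_tags, lifting) mem_Collect_eq)
  qed
qed

lemma Var_mult_mon_span:
  "{Var i * f | f. f \<in> mon_span U} = (mon_span ((+) (Poly_Mapping.single i 1) ` U) :: ('n, 'k::comm_ring_1) mpoly set)"
  by (simp add: mon_span_translate Var_def)

lemma multiples_zero: "multiples {0} = UNIV"
  by (auto simp: multiples_def)

lemma multiples_singleton: "multiples {u} = (+) u ` UNIV"
  by (auto simp: multiples_def)

text \<open>The ideals in the recursion are arbitrary subsets of \<open>S\<close>; only the closure of the base cases under
  splitting shows that they are monomial ideals in the variables \<open>V\<close>.\<close>

lemma vertex_splittable_in_monomial: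
  assumes "vertex_splittable_in V I"
  shows "\<exists>A. I = mon_span (multiples A) \<and> (\<forall>u\<in>A. supp u \<subseteq> V)"
  using assms
proof (induction rule: vertex_splittable_in.induct)
  case (principal u V)
  then show ?case by (intro exI[of _ "{u}"]) (simp add: ideal_gen_singleton_mon)
next
  case (zero V)
  show ?case by (rule exI[of _ "{}"]) simp
next
  case (unit V)
  show ?case by (rule exI[of _ "{0}"]) (simp add: multiples_zero supp_def)
next
  case (split i V I1 I2 xI1 I)
  then obtain A1 A2 where A: "I1 = mon_span (multiples A1)" "\<forall>u\<in>A1. supp u \<subseteq> V"
    "I2 = mon_span (multiples A2)" "\<forall>u\<in>A2. supp u \<subseteq> V - {i}" by blast
  let ?x = "Poly_Mapping.single i 1"
  have "I = mon_span (multiples ((+) ?x ` A1 \<union> A2))"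
    unfolding split.hyps A Var_mult_mon_span mon_span_plus multiples_Un multiples_translate ..
  moreover have "\<forall>u\<in>(+) ?x ` A1 \<union> A2. supp u \<subseteq> V"
    using A \<open>i \<in> V\<close> by (auto simp: supp_add) (auto simp: supp_def)
  ultimately show ?case by blast
qed

lemma vertex_splittable_in_mono:
  assumes "vertex_splittable_in V I" "V \<subseteq> W"
  shows "vertex_splittable_in W I"
  using assms
proof (induction arbitrary: W rule: vertex_splittable_in.induct)
  case (principal u V)
  then show ?case by (blast intro: vertex_splittable_in.principal)
next
  case (split i V I1 I2 xI1 I)
  show ?case
    by (rule vertex_splittable_in.split[OF _ split.IH(1) split.IH(2)]) (use split in blast)+
qed (auto intro: vertex_splittable_in.zero vertex_splittable_in.unit)

text \<open>As \<open>x\<^sub>i\<close> does not divide the generators of \<open>I\<^sub>2\<close>, a multiple of \<open>x\<^sub>i\<close> in \<open>I\<^sub>2\<close> is \<open>x\<^sub>i\<close> times a monomial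
  in \<open>I\<^sub>2\<close>. So the two parts \<open>x\<^sub>i I\<^sub>1\<close> and \<open>I\<^sub>2\<close> of a vertex splitting meet in \<open>x\<^sub>i I\<^sub>2\<close>.\<close>

lemma translate_Int_multiples:
  assumes "multiples C \<subseteq> U" "\<And>c. c \<in> C \<Longrightarrow> i \<notin> supp c"
  shows "(+) (Poly_Mapping.single i 1) ` U \<inter> multiples C = (+) (Poly_Mapping.single i 1) ` multiples C"
proof
  let ?x = "Poly_Mapping.single i (1::nat)"
  show "(+) ?x ` multiples C \<subseteq> (+) ?x ` U \<inter> multiples C"
    using assms(1) multiples_add[of _ C ?x] by (auto simp: add.commute)
  show "(+) ?x ` U \<inter> multiples C \<subseteq> (+) ?x ` multiples C"
  proof
    fix w assume w: "w \<in> (+) ?x ` U \<inter> multiples C"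
    then obtain u c v where *: "w = ?x + u" "c \<in> C" "w = c + v" by (auto elim!: multiplesE)
    have "Poly_Mapping.lookup (c + v) i = Poly_Mapping.lookup (?x + u) i" using * by simp
    then have "i \<in> supp v" using assms(2)[OF *(2)] by (auto simp: lookup_add supp_def in_keys_iff)
    then have "w = ?x + (c + (v - ?x))" using add_single_diff[of i v] *(3)
      by (metis add.left_commute)
    then show "w \<in> (+) ?x ` multiples C" using *(2) by (auto intro: multiplesI)
  qed
qed

text \<open>In a splitting \<open>I = x\<^sub>i I\<^sub>1 + I\<^sub>2\<close> with generators of degree \<open>e\<close>, the ideals \<open>x\<^sub>i I\<^sub>1\<close>, \<open>I\<^sub>2\<close> and their
  intersection \<open>x\<^sub>i I\<^sub>2\<close> are linear in degrees \<open>e\<close>, \<open>e\<close> and \<open>e + 1\<close> by induction, which is what the exact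
  sequence for \<open>Tor\<close> of a sum asks for. The degree \<open>e\<close> is an integer here, so that it can be lowered to \<open>e - 1\<close> for
  \<open>I\<^sub>1\<close> even if \<open>I\<^sub>1\<close> is zero and \<open>e = 0\<close>.\<close>

theorem vertex_splittable_in_linear_homology:
  fixes F :: "('n, 'k::comm_ring_1) free_complex"
  assumes F: "graded_free_resolution_of_K F"
  assumes "vertex_splittable_in V I" "\<forall>u\<in>min_mon_gens I. int (mdeg u) = e"
  shows "linear_homology F I e"
  using assms(2,3)
proof (induction arbitrary: e rule: vertex_splittable_in.induct)
  case (principal u V)
  have "min_exps (multiples {u}) = {u}"
    by (rule min_exps_multiples_equal_degree[where e = "mdeg u"]) simp
  then have "e = int (mdeg u)"
    using principal by (simp add: ideal_gen_singleton_mon min_mon_gens_mon_span)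
  moreover have "linear_homology F (mon_span ((+) u ` UNIV)) (0 + int (mdeg u))"
    by (rule linear_homology_translate) (simp add: linear_homology_UNIV[OF F])
  ultimately show ?case by (simp add: ideal_gen_singleton_mon multiples_singleton)
next
  case (zero V)
  have "v \<in> boundaries F {0} i" if "v \<in> cycles F {0} i" for v i
  proof -
    have "v = 0" using that by (auto simp: cycles_eq tensor_vecs_def fun_eq_iff) (meson not_le)
    moreover have "diff_map F i 0 = 0" by (simp add: diff_map_def fun_eq_iff)
    moreover have "0 \<in> tensor_vecs F {0} (Suc i)" by (simp add: tensor_vecs_def)
    ultimately show ?thesis unfolding boundaries_def by (metis image_eqI)
  qed
  then show ?case by (auto simp: linear_homology_def)
next
  case (unit V)
  have "min_mon_gens (mon_span (multiples {0}) :: ('n, 'k) mpoly set) = {0}"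
    unfolding min_mon_gens_mon_span by (rule min_exps_multiples_equal_degree[where e = 0]) auto
  then have "e = 0" using unit by (simp add: multiples_zero)
  then show ?case using linear_homology_UNIV[OF F] by simp
next
  case (split i V I1 I2 xI1 I)
  let ?x = "Poly_Mapping.single i (1::nat)"
  obtain A1 where A1: "I1 = mon_span (multiples A1)"
    using vertex_splittable_in_monomial[OF split.hyps(2)] by blast
  obtain A2 where A2: "I2 = mon_span (multiples A2)" "\<forall>u\<in>A2. supp u \<subseteq> V - {i}"
    using vertex_splittable_in_monomial[OF split.hyps(3)] by blast
  have x1: "xI1 = mon_span ((+) ?x ` multiples A1)"
    using split.hyps(4) by (simp add: A1 Var_mult_mon_span)
  have sub: "multiples A2 \<subseteq> multiples A1"
    using split.hyps(6) by (simp add: A1 A2 mon_span_subset_iff)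
  have "min_mon_gens xI1 = (+) ?x ` min_mon_gens I1"
    unfolding x1 A1 using min_mon_gens_mon_span[of "(+) ?x ` A1"]
    by (simp add: multiples_translate min_mon_gens_mon_span min_exps_translate)
  then have gens: "\<forall>u\<in>(+) ?x ` min_mon_gens I1 \<union> min_mon_gens I2. int (mdeg u) = e"
    using split.prems split.hyps(7) by simp
  have gens1: "\<forall>u\<in>min_mon_gens I1. int (mdeg u) = e - 1"
  proof
    fix u assume "u \<in> min_mon_gens I1"
    then have "int (mdeg (?x + u)) = e" using gens by blast
    then show "int (mdeg u) = e - 1" by (simp add: mdeg_add)
  qed
  from gens have gens2: "\<forall>u\<in>min_mon_gens I2. int (mdeg u) = e" by blast
  have 1: "linear_homology F (mon_span (multiples A1)) (e - 1)"
    using split.IH(1)[OF gens1] A1 by simp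
  have 2: "linear_homology F (mon_span (multiples A2)) e"
    using split.IH(2)[OF gens2] A2 by simp
  have "linear_homology F (mon_span ((+) ?x ` multiples A1 \<union> multiples A2)) e"
  proof (rule linear_homology_Un)
    show "graded_diffs F" by (rule graded_free_resolution_of_KD(1)[OF F])
    show "multiples ((+) ?x ` multiples A1) = (+) ?x ` multiples A1"
      by (simp add: multiples_translate)
    show "linear_homology F (mon_span ((+) ?x ` multiples A1)) e"
      using linear_homology_translate[OF 1, of ?x] by simp
    have "(+) ?x ` multiples A1 \<inter> multiples A2 = (+) ?x ` multiples A2"
      by (rule translate_Int_multiples[OF sub]) (use A2 in blast)
    then show "linear_homology F (mon_span ((+) ?x ` multiples A1 \<inter> multiples A2)) (e + 1)"
      using linear_homology_translate[OF 2, of ?x] by simp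
    show "diff_map F i (diff_map F (Suc i) v) = 0" if "v \<in> tensor_vecs F UNIV (Suc (Suc i))" for i v
      by (rule resolution_diff_diff[OF F that])
  qed (simp_all add: 2)
  then show ?case using split.hyps(5) by (simp add: x1 A2 mon_span_plus)
qed

text \<open>For generators of equal degree, the condition on minimal generators holds automatically: the union
  has no proper divisibilities, and the variable divides the generators in one part only.\<close>

lemma vertex_splittable_in_splitI:
  assumes "i \<in> V"
    and B: "vertex_splittable_in V (ideal_gen (mon ` B) :: ('n, 'k::comm_ring_1) mpoly set)"
    and C: "vertex_splittable_in (V - {i}) (ideal_gen (mon ` C) :: ('n, 'k) mpoly set)"
    and sub: "C \<subseteq> multiples B"
    and deg: "\<And>b. b \<in> B \<Longrightarrow> mdeg b = e" "\<And>c. c \<in> C \<Longrightarrow> mdeg c = Suc e"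
    and i: "\<And>c. c \<in> C \<Longrightarrow> i \<notin> supp c"
  shows "vertex_splittable_in V
    (ideal_gen (mon ` ((+) (Poly_Mapping.single i 1) ` B \<union> C)) :: ('n, 'k) mpoly set)"
proof (rule vertex_splittable_in.split[OF \<open>i \<in> V\<close> B C])
  let ?x = "Poly_Mapping.single i (1::nat)"
  let ?I = "\<lambda>A. ideal_gen (mon ` A) :: ('n, 'k) mpoly set"
  show "?I ((+) ?x ` B) = {Var i * f | f. f \<in> ?I B}"
    by (simp add: ideal_gen_mon Var_mult_mon_span multiples_translate)
  show "?I ((+) ?x ` B \<union> C) = {f + g | f g. f \<in> ?I ((+) ?x ` B) \<and> g \<in> ?I C}"
    by (simp add: ideal_gen_mon multiples_Un mon_span_plus)
  show "?I C \<subseteq> ?I B" using sub by (simp add: ideal_gen_mon mon_span_subset_iff multiples_subset_iff)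
  have d: "mdeg a = Suc e" if "a \<in> (+) ?x ` B \<union> C" for a using that deg by (auto simp: mdeg_add)
  have "min_mon_gens (?I ((+) ?x ` B \<union> C)) = (+) ?x ` B \<union> C"
    by (rule min_mon_gens_ideal_gen[OF d])
  moreover have x: "min_mon_gens (?I ((+) ?x ` B)) = (+) ?x ` B" and "min_mon_gens (?I C) = C"
    using d by (auto intro!: min_mon_gens_ideal_gen[where e = "Suc e"])
  ultimately show "min_mon_gens (?I ((+) ?x ` B \<union> C)) = min_mon_gens (?I ((+) ?x ` B)) \<union> min_mon_gens (?I C)"
    by simp
  have "(+) ?x ` B \<inter> C = {}"
    using i by (fastforce simp: supp_def in_keys_iff lookup_add)
  then show "min_mon_gens (?I ((+) ?x ` B)) \<inter> min_mon_gens (?I C) = {}"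
    unfolding x \<open>min_mon_gens (?I C) = C\<close> .
qed

section \<open>Dimension of Tor and regularity\<close>

lemma lookup_single_0_mult:
  fixes f :: "('n, 'k::comm_ring_1) mpoly"
  shows "Poly_Mapping.lookup (Poly_Mapping.single 0 c * f) u = c * Poly_Mapping.lookup f u"
proof -
  have "Poly_Mapping.single 0 c * f = Poly_Mapping.single 0 c *
      (\<Sum>u\<in>Poly_Mapping.keys f. Poly_Mapping.single u (Poly_Mapping.lookup f u))"
    using poly_mapping_eq_sum_single[of f] by simp
  also have "\<dots> = (\<Sum>u\<in>Poly_Mapping.keys f. Poly_Mapping.single u (c * Poly_Mapping.lookup f u))"
    by (simp add: sum_distrib_left mult_single)
  finally show ?thesis
    by (auto simp: lookup_sum lookup_single when_def in_keys_iff)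
qed

lemma vector_space_vec_scale: "vector_space (vec_scale :: 'k::field \<Rightarrow> (nat \<Rightarrow> ('n, 'k) mpoly) \<Rightarrow> _)"
proof
  fix a b :: 'k and v w :: "nat \<Rightarrow> ('n, 'k) mpoly"
  show "vec_scale a (v + w) = vec_scale a v + vec_scale a w"
    by (rule ext) (simp add: vec_scale_def distrib_left)
  show "vec_scale (a + b) v = vec_scale a v + vec_scale b v"
    by (rule ext) (simp add: vec_scale_def Const_def single_add distrib_right)
  show "vec_scale a (vec_scale b v) = vec_scale (a * b) v"
    by (rule ext) (simp add: vec_scale_def Const_def mult_single flip: mult.assoc)
  show "vec_scale 1 v = v"
    by (rule ext) (simp add: vec_scale_def Const_def)
qed

interpretation vec: vector_space "vec_scale :: 'k::field \<Rightarrow> (nat \<Rightarrow> ('n, 'k) mpoly) \<Rightarrow> _"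
  by (rule vector_space_vec_scale)

text \<open>The dimension of an infinite-dimensional space is \<open>0\<close> by convention, so strict monotonicity rests on a
  finite set \<open>W\<close> that spans the larger space.\<close>

lemma (in vector_space) dim_strict_mono:
  assumes "subspace B" "B \<subseteq> C" "v \<in> C" "v \<notin> B" "C \<subseteq> span W" "finite W"
  shows "dim B < dim C"
proof -
  obtain b where b: "b \<subseteq> B" "independent b" "B \<subseteq> span b" "card b = dim B"
    using basis_exists[of B] by blast
  have "span b \<subseteq> B" using b(1) assms(1) by (rule span_minimal)
  then have v: "v \<notin> span b" using assms(4) by blast
  then have "independent (insert v b)" using b(2) by (rule independent_insertI)
  moreover have "insert v b \<subseteq> C" using b(1) assms(2,3) by blast
  ultimately obtain c where c: "insert v b \<subseteq> c" "c \<subseteq> C" "independent c" "C \<subseteq> span c"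
    using maximal_independent_subset_extend[of "insert v b" C] by blast
  have fin: "finite c" using independent_span_bound[OF \<open>finite W\<close> c(3)] c(2) assms(5) by blast
  have "v \<notin> b" using v span_base by blast
  moreover have "finite b" using finite_subset[of b c] fin c(1) by blast
  ultimately have "card b < card (insert v b)" by simp
  also have "\<dots> \<le> card c" using fin c(1) by (rule card_mono)
  also have "\<dots> = dim C" using c by (intro basis_card_eq_dim)
  finally show ?thesis using b(4) by simp
qed

lemma finite_mdeg_eq: "finite {u :: 'n::finite expo. int (mdeg u) = e}"
proof (rule finite_imageD)
  show "inj_on Poly_Mapping.lookup {u :: 'n expo. int (mdeg u) = e}"
    by (rule inj_onI) (metis poly_mapping_eq_iff)
  have "Poly_Mapping.lookup u i \<le> mdeg u" for u :: "'n expo" and i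
  proof -
    have "mdeg u = (\<Sum>i\<in>UNIV. Poly_Mapping.lookup u i)" by (rule mdeg_eq_sum) auto
    then show ?thesis by (simp add: member_le_sum)
  qed
  then have "Poly_Mapping.lookup ` {u :: 'n expo. int (mdeg u) = e} \<subseteq> {f. \<forall>i. f i \<in> {..nat e}}"
    by force
  moreover have "finite {f :: 'n \<Rightarrow> nat. \<forall>i. f i \<in> {..nat e}}"
    using finite_set_of_finite_funs[of "UNIV :: 'n set" "{..nat e}" 0] by simp
  ultimately show "finite (Poly_Mapping.lookup ` {u :: 'n expo. int (mdeg u) = e})"
    by (rule finite_subset)
qed

definition unit_vec :: "nat \<Rightarrow> ('n, 'k::zero) mpoly \<Rightarrow> nat \<Rightarrow> ('n, 'k) mpoly"
  where "unit_vec k f = (\<lambda>k'. if k' = k then f else 0)"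

lemma sum_fun_apply: "(\<Sum>x\<in>X. f x) k = (\<Sum>x\<in>X. f x k)"
  for f :: "'a \<Rightarrow> 'b \<Rightarrow> 'c::comm_monoid_add"
  by (induction X rule: infinite_finite_induct) auto

lemma finite_dim_degree_part:
  fixes F :: "('n::finite, 'k::field) free_complex"
  obtains W where "finite W" "tensor_vecs F UNIV i \<inter> degree_part F i j \<subseteq> vec.span W"
proof
  let ?W = "\<Union>k<rank F i. (\<lambda>u. unit_vec k (mon u) :: nat \<Rightarrow> ('n, 'k) mpoly) ` {u. int (mdeg u) = j - shift F i k}"
  show "finite ?W" by (intro finite_UN_I finite_imageI finite_mdeg_eq finite_lessThan)
  show "tensor_vecs F UNIV i \<inter> degree_part F i j \<subseteq> vec.span ?W"
  proof
    fix v assume v: "v \<in> tensor_vecs F UNIV i \<inter> degree_part F i j"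
    have "v = (\<Sum>k<rank F i. \<Sum>u\<in>Poly_Mapping.keys (v k).
        vec_scale (Poly_Mapping.lookup (v k) u) (unit_vec k (mon u)))" (is "v = ?s")
    proof (rule ext)
      fix k'
      have "?s k' = (\<Sum>k<rank F i. if k' = k then
          \<Sum>u\<in>Poly_Mapping.keys (v k). Poly_Mapping.single u (Poly_Mapping.lookup (v k) u) else 0)"
        unfolding sum_fun_apply
        by (rule sum.cong[OF refl]) (simp add: vec_scale_def unit_vec_def mon_def Const_def mult_single)
      also have "\<dots> = v k'"
        using v by (auto simp: tensor_vecs_def simp flip: poly_mapping_eq_sum_single)
      finally show "v k' = ?s k'" by simp
    qed
    also have "\<dots> \<in> vec.span ?W"
      by (intro vec.span_sum vec.span_scale vec.span_base)
         (use v in \<open>auto simp: degree_part_def homogeneous_deg_def\<close>)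
    finally show "v \<in> vec.span ?W" .
  qed
qed

lemma subspace_boundaries_degree_part:
  "vec.subspace (boundaries F (mon_span U) i \<inter> degree_part F i j)"
  if "multiples U = U" for F :: "('n, 'k::field) free_complex"
  unfolding vec.subspace_def
proof (intro conjI ballI allI)
  have z: "diff_map F i 0 = 0" by (simp add: diff_map_def fun_eq_iff)
  have "0 \<in> tensor_vecs F (mon_span U) (Suc i)" by (simp add: tensor_vecs_def)
  then have "0 \<in> boundaries F (mon_span U) i" unfolding boundaries_def by (metis image_eqI z)
  then show "0 \<in> boundaries F (mon_span U) i \<inter> degree_part F i j"
    by (simp add: degree_part_iff)
next
  fix v w assume "v \<in> boundaries F (mon_span U) i \<inter> degree_part F i j"
    "w \<in> boundaries F (mon_span U) i \<inter> degree_part F i j"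
  then show "v + w \<in> boundaries F (mon_span U) i \<inter> degree_part F i j"
    by (auto intro: boundaries_add degree_part_add)
next
  fix a v assume v: "v \<in> boundaries F (mon_span U) i \<inter> degree_part F i j"
  then obtain w where w: "w \<in> tensor_vecs F (mon_span U) (Suc i)" "v = diff_map F i w"
    by (auto simp: boundaries_def)
  have "vec_scale a v = diff_map F i (vec_scale a w)"
    by (simp add: w(2) vec_scale_def diff_map_scale)
  moreover have "vec_scale a w \<in> tensor_vecs F (mon_span U) (Suc i)"
    using w(1) that by (auto simp: vec_scale_def tensor_vecs_def intro: mon_span_mult)
  moreover have "vec_scale a v \<in> degree_part F i j"
    using v by (fastforce simp: degree_part_iff vec_scale_def mon_span_def Const_def in_keys_iff
        lookup_single_0_mult)
  ultimately show "vec_scale a v \<in> boundaries F (mon_span U) i \<inter> degree_part F i j"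
    by (auto simp: boundaries_def)
qed

text \<open>If \<open>f\<close> has no monomial of lower degree than \<open>u\<close>, then only the constant term of \<open>D\<close> can contribute to the
  coefficient of \<open>u\<close> in \<open>D * f\<close>.\<close>

lemma lookup_mult_initial_degree:
  fixes D f :: "('n, 'k::comm_ring_1) mpoly"
  assumes "\<And>w. w \<in> Poly_Mapping.keys f \<Longrightarrow> mdeg u \<le> mdeg w"
  shows "Poly_Mapping.lookup (D * f) u = Poly_Mapping.lookup D 0 * Poly_Mapping.lookup f u"
proof -
  have "u \<notin> Poly_Mapping.keys (restr (- {0}) D * f)"
  proof
    assume "u \<in> Poly_Mapping.keys (restr (- {0}) D * f)"
    then obtain a b where "a \<noteq> 0" "b \<in> Poly_Mapping.keys f" "u = a + b"
      using keys_mult[of "restr (- {0}) D" f] by (auto simp: keys_restr)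
    then show False using assms[of b] by (simp add: mdeg_add)
  qed
  then have "Poly_Mapping.lookup (restr (- {0}) D * f) u = 0" by (simp add: in_keys_iff)
  moreover have "restr {0} D = Poly_Mapping.single 0 (Poly_Mapping.lookup D 0)"
    by (rule poly_mapping_eqI) (auto simp: lookup_restr lookup_single)
  moreover have "D * f = restr {0} D * f + restr (- {0}) D * f"
    by (simp flip: distrib_right add: restr_add_compl)
  ultimately show ?thesis by (simp add: lookup_add lookup_single_0_mult)
qed

text \<open>A generator \<open>u\<close> of lowest degree survives in \<open>Tor\<^sub>0(K, I) = I/(x\<^sub>1, \<dots>, x\<^sub>n)I\<close>: the functional that takes
  the coefficient of \<open>u\<close> after applying the augmentation vanishes on boundaries, because the
  augmentation vanishes on the columns of the first differential. The matrices may contain nonzero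
  constants, as \<open>F\<close> is an arbitrary, possibly non-minimal, resolution.\<close>

lemma lowest_generator_not_boundary:
  fixes F :: "('n, 'k::comm_ring_1) free_complex"
  assumes F: "graded_free_resolution_of_K F"
    and U: "\<And>w. w \<in> U \<Longrightarrow> mdeg u \<le> mdeg w"
    and k: "k < rank F 0" "aug F k \<noteq> 0"
  shows "unit_vec k (mon u) \<notin> boundaries F (mon_span U) 0"
proof
  define \<phi> where "\<phi> v = (\<Sum>r<rank F 0. aug F r * Poly_Mapping.lookup (v r) u)"
    for v :: "nat \<Rightarrow> ('n, 'k) mpoly"
  assume "unit_vec k (mon u) \<in> boundaries F (mon_span U) 0"
  then obtain w where w: "w \<in> tensor_vecs F (mon_span U) 1" "unit_vec k (mon u) = diff_map F 0 w"
    by (auto simp: boundaries_def)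
  have col: "(\<Sum>r<rank F 0. aug F r * Poly_Mapping.lookup (diff F 0 r c) 0) = 0" if c: "c < rank F 1" for c
  proof -
    have "unit_vec c 1 \<in> tensor_vecs F UNIV 1" using c by (auto simp: tensor_vecs_def unit_vec_def)
    then have "diff_map F 0 (unit_vec c 1) \<in> boundaries F UNIV 0" by (auto simp: boundaries_def)
    then have "(\<Sum>r<rank F 0. Poly_Mapping.lookup (diff_map F 0 (unit_vec c 1) r) 0 * aug F r) = 0"
      using graded_free_resolution_of_KD(3)[OF F] by blast
    moreover have "diff_map F 0 (unit_vec c 1) r = diff F 0 r c" if "r < rank F 0" for r
      using that c by (simp add: diff_map_def unit_vec_def if_distrib cong: if_cong)
    ultimately show ?thesis by (simp add: mult.commute)
  qed
  have "\<phi> (unit_vec k (mon u)) = (\<Sum>r<rank F 0. if r = k then aug F k else 0)"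
    unfolding \<phi>_def by (rule sum.cong) (auto simp: unit_vec_def mon_def)
  then have "\<phi> (unit_vec k (mon u)) = aug F k" using k(1) by simp
  moreover have "\<phi> (diff_map F 0 w) = 0"
  proof -
    have "\<phi> (diff_map F 0 w) = (\<Sum>r<rank F 0. \<Sum>c<rank F 1.
        aug F r * Poly_Mapping.lookup (diff F 0 r c) 0 * Poly_Mapping.lookup (w c) u)"
      unfolding \<phi>_def
    proof (rule sum.cong[OF refl])
      fix r assume r: "r \<in> {..<rank F 0}"
      have "Poly_Mapping.lookup (diff F 0 r c * w c) u
          = Poly_Mapping.lookup (diff F 0 r c) 0 * Poly_Mapping.lookup (w c) u" if "c < rank F 1" for c
        by (rule lookup_mult_initial_degree) (use w(1) that U in \<open>auto simp: tensor_vecs_def mon_span_def\<close>)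
      then have "(\<Sum>c<rank F 1. Poly_Mapping.lookup (diff F 0 r c * w c) u)
          = (\<Sum>c<rank F 1. Poly_Mapping.lookup (diff F 0 r c) 0 * Poly_Mapping.lookup (w c) u)"
        by (intro sum.cong) auto
      moreover have "Poly_Mapping.lookup (diff_map F 0 w r) u
          = (\<Sum>c<rank F 1. Poly_Mapping.lookup (diff F 0 r c * w c) u)"
        using r by (simp add: diff_map_def lookup_sum)
      ultimately show "aug F r * Poly_Mapping.lookup (diff_map F 0 w r) u = (\<Sum>c<rank F 1.
          aug F r * Poly_Mapping.lookup (diff F 0 r c) 0 * Poly_Mapping.lookup (w c) u)"
        by (simp only: sum_distrib_left mult.assoc)
    qed
    also have "\<dots> = (\<Sum>c<rank F 1. (\<Sum>r<rank F 0. aug F r * Poly_Mapping.lookup (diff F 0 r c) 0)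
        * Poly_Mapping.lookup (w c) u)"
      by (subst sum.swap) (simp add: sum_distrib_right)
    finally show ?thesis by (simp add: col)
  qed
  ultimately show False using w(2) k(2) by simp
qed

text \<open>All nonzero \<open>Tor\<^sub>i(K, I)\<^sub>j\<close> have \<open>j - i = e\<close>, and \<open>Tor\<^sub>0(K, I)\<^sub>e\<close> is nonzero; so the set whose maximum is the
  regularity is \<open>{e}\<close>. Linearity is required for every resolution because \<open>dim_Tor\<close> chooses an
  unspecified one.\<close>

theorem reg_linear:
  fixes A :: "'n::finite expo set"
  defines "I \<equiv> ideal_gen (mon ` A) :: ('n, 'k::field) mpoly set"
  assumes ex: "\<exists>F :: ('n, 'k) free_complex. graded_free_resolution_of_K F"
    and A: "A \<noteq> {}" "\<And>a. a \<in> A \<Longrightarrow> mdeg a = e"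
    and lin: "\<And>F. graded_free_resolution_of_K F \<Longrightarrow> linear_homology F I (int e)"
  shows "reg I = int e"
proof -
  define F where "F = (SOME F :: ('n, 'k) free_complex. graded_free_resolution_of_K F)"
  have F: "graded_free_resolution_of_K F" unfolding F_def using ex by (rule someI_ex)
  let ?U = "multiples A"
  have I: "I = mon_span ?U" by (simp add: I_def ideal_gen_mon)
  have UD: "e \<le> mdeg w" if "w \<in> ?U" for w
    using that A(2) by (auto elim!: multiplesE simp: mdeg_add)
  have dim: "dim_Tor i I j = vec.dim (cycles F I i \<inter> degree_part F i j)
    - vec.dim (boundaries F I i \<inter> degree_part F i j)" for i j
    by (simp add: dim_Tor_def F_def Let_def)
  have bc: "boundaries F I i \<subseteq> cycles F I i" for i
  proof
    fix z assume "z \<in> boundaries F I i"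
    then obtain w where w: "w \<in> tensor_vecs F I (Suc i)" "z = diff_map F i w"
      by (auto simp: boundaries_def)
    then have "z \<in> tensor_vecs F I i" by (simp add: I diff_map_tensor_vecs)
    then show "z \<in> cycles F I i"
      using w resolution_diff_diff[OF F] tensor_vecs_mono[of I UNIV F] by (auto simp: cycles_eq)
  qed
  have zero: "dim_Tor i I j = 0" if "j \<noteq> int i + int e" for i j
  proof -
    have "cycles F I i \<inter> degree_part F i j = boundaries F I i \<inter> degree_part F i j"
      using lin[OF F] bc[of i] that unfolding linear_homology_def by blast
    then show ?thesis by (simp add: dim)
  qed
  have nonzero: "dim_Tor 0 I (int e) \<noteq> 0"
  proof -
    obtain u where u: "u \<in> A" using A(1) by blast
    obtain v :: "nat \<Rightarrow> ('n, 'k) mpoly"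
      where "(\<Sum>k<rank F 0. Poly_Mapping.lookup (v k) 0 * aug F k) = 1"
      using graded_free_resolution_of_KD(5)[OF F] by blast
    then obtain k where k: "k < rank F 0" "aug F k \<noteq> 0"
      by (metis (no_types, lifting) lessThan_iff mult_zero_right sum.neutral zero_neq_one)
    let ?z = "unit_vec k (mon u) :: nat \<Rightarrow> ('n, 'k) mpoly"
    have "?z \<in> cycles F I 0"
      using k u subset_multiples[of A] by (auto simp: I tensor_vecs_def unit_vec_def)
    moreover have "?z \<in> degree_part F 0 (int e)"
      using A(2)[OF u] graded_free_resolution_of_KD(2)[OF F k] by (simp add: degree_part_iff unit_vec_def)
    moreover have "?z \<notin> boundaries F I 0"
      unfolding I by (rule lowest_generator_not_boundary[OF F _ k]) (use UD A(2)[OF u] in auto)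
    moreover obtain W where "finite W" "tensor_vecs F UNIV 0 \<inter> degree_part F 0 (int e) \<subseteq> vec.span W"
      by (rule finite_dim_degree_part)
    moreover have "cycles F I 0 \<subseteq> tensor_vecs F UNIV 0" by (auto simp: tensor_vecs_def)
    ultimately have "vec.dim (boundaries F I 0 \<inter> degree_part F 0 (int e))
        < vec.dim (cycles F I 0 \<inter> degree_part F 0 (int e))"
      using bc[of 0]
      by (intro vec.dim_strict_mono[where v = ?z and W = W])
         (auto simp del: cycles.simps simp: I subspace_boundaries_degree_part)
    then show ?thesis by (simp add: dim)
  qed
  have "{j - int i | i j. dim_Tor i I j \<noteq> 0} = {int e}"
  proof (rule set_eqI, rule iffI)
    fix x assume "x \<in> {j - int i | i j. dim_Tor i I j \<noteq> 0}"
    then obtain i j where x: "x = j - int i" and "dim_Tor i I j \<noteq> 0" by blast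
    then have "j = int i + int e" using zero by metis
    then show "x \<in> {int e}" by (simp add: x)
  next
    fix x assume "x \<in> {int e}"
    then have "x = int e - int 0" by simp
    then show "x \<in> {j - int i | i j. dim_Tor i I j \<noteq> 0}" using nonzero by blast
  qed
  then show ?thesis by (simp add: reg_def)
qed

section \<open>Existence of a graded free resolution of the residue field\<close>

text \<open>The mapping cone of multiplication by \<open>x\<close> on \<open>F\<close>. It has \<open>F\<^sub>i \<oplus> F\<^sub>i\<^sub>-\<^sub>1(-1)\<close> in homological degree \<open>i\<close>, the
  summand \<open>F\<^sub>i\<close> occupying the first \<open>rank F i\<close> positions, and the differential
  \<open>(a, b) \<mapsto> (d a + x b, - d b)\<close>.\<close>

definition cone :: "'n \<Rightarrow> ('n, 'k::comm_ring_1) free_complex \<Rightarrow> ('n, 'k) free_complex"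
  where "cone x F =
    \<lparr>rank = (\<lambda>i. rank F i + (case i of 0 \<Rightarrow> 0 | Suc i' \<Rightarrow> rank F i')),
     shift = (\<lambda>i k. if k < rank F i then shift F i k
       else (case i of 0 \<Rightarrow> 0 | Suc i' \<Rightarrow> shift F i' (k - rank F i) + 1)),
     diff = (\<lambda>i r c.
       if c < rank F (Suc i) then (if r < rank F i then diff F i r c else 0)
       else if r < rank F i then (if r = c - rank F (Suc i) then Var x else 0)
       else (case i of 0 \<Rightarrow> 0 | Suc i' \<Rightarrow> - diff F i' (r - rank F i) (c - rank F (Suc i)))),
     aug = aug F\<rparr>"

definition join :: "nat \<Rightarrow> (nat \<Rightarrow> 'a) \<Rightarrow> (nat \<Rightarrow> 'a) \<Rightarrow> nat \<Rightarrow> 'a"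
  where "join n a b = (\<lambda>k. if k < n then a k else b (k - n))"

lemma rank_cone: "rank (cone x F) 0 = rank F 0"
  "rank (cone x F) (Suc i) = rank F (Suc i) + rank F i"
  by (simp_all add: cone_def)

lemma sum_lessThan_add: "(\<Sum>k<n + m. f k) = (\<Sum>k<n. f k) + (\<Sum>k<m. f (n + k))"
  for f :: "nat \<Rightarrow> 'a::comm_monoid_add"
  by (induction m) (auto simp: add.assoc)

lemma tensor_vecs_UNIV: "v \<in> tensor_vecs F UNIV i \<longleftrightarrow> (\<forall>k\<ge>rank F i. v k = 0)"
  by (simp add: tensor_vecs_def)

lemma diff_map_in_tensor: "diff_map F i v \<in> tensor_vecs F UNIV i"
  by (simp add: tensor_vecs_UNIV diff_map_def)

lemma join_tensor_vecs:
  assumes "b \<in> tensor_vecs F UNIV i"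
  shows "join (rank F (Suc i)) a b \<in> tensor_vecs (cone x F) UNIV (Suc i)"
  using assms by (auto simp: tensor_vecs_UNIV rank_cone join_def)

lemma tensor_vecs_cone_cases:
  assumes "v \<in> tensor_vecs (cone x F) UNIV (Suc i)"
  obtains a b where "a \<in> tensor_vecs F UNIV (Suc i)" "b \<in> tensor_vecs F UNIV i"
    "v = join (rank F (Suc i)) a b"
proof
  let ?n = "rank F (Suc i)"
  show "(\<lambda>k. if k < ?n then v k else 0) \<in> tensor_vecs F UNIV (Suc i)" by (simp add: tensor_vecs_UNIV)
  show "(\<lambda>k. v (?n + k)) \<in> tensor_vecs F UNIV i"
    using assms by (simp add: tensor_vecs_UNIV rank_cone)
  show "v = join ?n (\<lambda>k. if k < ?n then v k else 0) (\<lambda>k. v (?n + k))"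
    by (rule ext) (simp add: join_def)
qed

text \<open>The differential that leaves \<open>F\<^sub>i\<close>, which is zero on \<open>F\<^sub>0\<close>.\<close>

definition prev_diff :: "('n, 'k::comm_ring_1) free_complex \<Rightarrow> nat \<Rightarrow> (nat \<Rightarrow> ('n, 'k) mpoly) \<Rightarrow> nat \<Rightarrow> ('n, 'k) mpoly"
  where "prev_diff F i b = (case i of 0 \<Rightarrow> 0 | Suc i' \<Rightarrow> diff_map F i' b)"

lemma prev_diff_0 [simp]: "prev_diff F 0 b = 0"
  and prev_diff_Suc [simp]: "prev_diff F (Suc i) b = diff_map F i b"
  by (simp_all add: prev_diff_def)

lemma diff_map_cone:
  fixes F :: "('n, 'k::comm_ring_1) free_complex"
  assumes b: "b \<in> tensor_vecs F UNIV i"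
  shows "diff_map (cone x F) i (join (rank F (Suc i)) a b)
    = join (rank F i) (\<lambda>k. diff_map F i a k + Var x * b k) (- prev_diff F i b)"
proof (rule ext)
  fix r
  let ?n = "rank F (Suc i)" and ?D = "diff (cone x F) i r" and ?v = "join (rank F (Suc i)) a b"
  have rank: "rank (cone x F) (Suc i) = ?n + rank F i" by (simp add: rank_cone)
  have sum: "(\<Sum>c<rank (cone x F) (Suc i). ?D c * ?v c)
      = (\<Sum>c<?n. ?D c * a c) + (\<Sum>c<rank F i. ?D (?n + c) * b c)"
    unfolding rank sum_lessThan_add by (simp add: join_def)
  show "diff_map (cone x F) i ?v r = join (rank F i) (\<lambda>k. diff_map F i a k + Var x * b k) (- prev_diff F i b) r"
  proof (cases "r < rank F i")
    case True
    have "(\<Sum>c<rank F i. ?D (?n + c) * b c) = (\<Sum>c<rank F i. if c = r then Var x * b c else 0)"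
      using True by (intro sum.cong) (auto simp: cone_def)
    also have "\<dots> = Var x * b r" using True by simp
    finally have "(\<Sum>c<rank (cone x F) (Suc i). ?D c * ?v c) = (\<Sum>c<?n. diff F i r c * a c) + Var x * b r"
      unfolding sum using True by (simp add: cone_def)
    moreover have "r < rank (cone x F) i" using True by (simp add: cone_def)
    ultimately show ?thesis using True by (simp add: diff_map_def join_def)
  next
    case False
    show ?thesis
    proof (cases i)
      case 0
      then show ?thesis using False by (simp add: diff_map_def join_def rank_cone)
    next
      case (Suc i')
      have "(\<Sum>c<?n. ?D c * a c) = 0" using False by (intro sum.neutral) (auto simp: cone_def)
      moreover have "(\<Sum>c<rank F i. ?D (?n + c) * b c) = - (\<Sum>c<rank F i. diff F i' (r - rank F i) c * b c)"
        unfolding sum_negf[symmetric] using False Suc by (intro sum.cong) (auto simp: cone_def)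
      ultimately show ?thesis
        unfolding diff_map_def sum using False Suc by (auto simp: join_def rank_cone diff_map_def)
    qed
  qed
qed

lemma homogeneous_deg_Var: "homogeneous_deg 1 (Var x :: ('n, 'k::comm_ring_1) mpoly)"
  by (simp add: homogeneous_deg_def Var_def mon_def)

lemma homogeneous_deg_0 [simp]: "homogeneous_deg e 0"
  by (simp add: homogeneous_deg_def)

lemma homogeneous_deg_uminus:
  "homogeneous_deg e f \<Longrightarrow> homogeneous_deg e (- f)" for f :: "('n, 'k::comm_ring_1) mpoly"
  by (simp add: homogeneous_deg_iff mon_span_uminus)

lemma graded_diffs_cone:
  assumes "graded_diffs F"
  shows "graded_diffs (cone x F)"
  unfolding graded_diffs_def
proof (intro allI impI)
  fix i r c assume r: "r < rank (cone x F) i" and c: "c < rank (cone x F) (Suc i)"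
  have F: "homogeneous_deg (shift F (Suc i) c - shift F i r) (diff F i r c)"
    if "r < rank F i" "c < rank F (Suc i)" for i r c using assms that by (simp add: graded_diffs_def)
  show "homogeneous_deg (shift (cone x F) (Suc i) c - shift (cone x F) i r) (diff (cone x F) i r c)"
  proof (cases i)
    case 0
    then show ?thesis using r c F[of r 0 c] homogeneous_deg_Var[of x] by (auto simp: cone_def)
  next
    case (Suc i')
    have "r - rank F i < rank F i'" "c - rank F (Suc i) < rank F i"
      if "\<not> r < rank F i" "\<not> c < rank F (Suc i)" using r c that Suc by (auto simp: rank_cone)
    then show ?thesis
      using r c F[of r i c] F[of "r - rank F i" i' "c - rank F (Suc i)"] homogeneous_deg_Var[of x] Suc
      by (auto simp: cone_def homogeneous_deg_uminus)
  qed
qed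

text \<open>A graded free resolution of \<open>S/(x\<^sub>i : i \<in> V)\<close>; the cyclic module is encoded by its ideal of
  relations, which consists of the polynomials all of whose monomials involve a variable in \<open>V\<close>.\<close>

definition resolves_mod_vars :: "'n set \<Rightarrow> ('n, 'k::comm_ring_1) free_complex \<Rightarrow> bool"
  where "resolves_mod_vars V F \<longleftrightarrow> graded_diffs F \<and> rank F 0 = 1 \<and> shift F 0 0 = 0 \<and> aug F 0 = 1 \<and>
    boundaries F UNIV 0 = {v \<in> tensor_vecs F UNIV 0. v 0 \<in> mon_span {u. supp u \<inter> V \<noteq> {}}} \<and>
    (\<forall>i. cycles F UNIV (Suc i) = boundaries F UNIV (Suc i))"

lemma resolves_mod_vars_empty:
  "\<exists>F :: ('n, 'k::comm_ring_1) free_complex. resolves_mod_vars {} F"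
proof
  let ?F = "\<lparr>rank = (\<lambda>i. if i = 0 then 1 else 0), shift = (\<lambda>_ _. 0), diff = (\<lambda>_ _ _. 0), aug = (\<lambda>_. 1)\<rparr>
    :: ('n, 'k) free_complex"
  have d: "diff_map ?F i v = 0" for i v by (rule ext) (simp add: diff_map_def)
  have T: "tensor_vecs ?F UNIV (Suc i) = {0}" for i
    by (auto simp: tensor_vecs_UNIV)
  have "boundaries ?F UNIV i = {0}" for i by (auto simp: boundaries_def d T)
  moreover have "cycles ?F UNIV (Suc i) = {0}" for i using d[of i 0] by (auto simp: T)
  moreover have "{v \<in> tensor_vecs ?F UNIV 0. v 0 = 0} = {0}"
  proof -
    have "v = 0" if "v 0 = 0" "\<forall>k\<ge>1. v k = 0" for v :: "nat \<Rightarrow> ('n, 'k) mpoly"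
    proof (rule ext)
      fix k show "v k = 0 k" using that by (cases "k = 0") auto
    qed
    then show ?thesis by (auto simp: tensor_vecs_UNIV)
  qed
  ultimately show "resolves_mod_vars {} ?F"
    by (simp add: resolves_mod_vars_def graded_diffs_def)
qed

lemma supp_add_single: "k \<noteq> 0 \<Longrightarrow> supp (Poly_Mapping.single x k + u) = insert x (supp u)"
  unfolding supp_add by (simp add: supp_def)

lemma keys_Var_mult:
  fixes f :: "('n, 'k::comm_ring_1) mpoly"
  shows "Poly_Mapping.keys (Var x * f) = (+) (Poly_Mapping.single x 1) ` Poly_Mapping.keys f"
  by (simp only: Var_def keys_mon_mult)

lemma Var_mult_in_mon_span_iff:
  fixes f :: "('n, 'k::comm_ring_1) mpoly"
  assumes "x \<notin> V"
  shows "Var x * f \<in> mon_span {u. supp u \<inter> V \<noteq> {}} \<longleftrightarrow> f \<in> mon_span {u. supp u \<inter> V \<noteq> {}}"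
  using assms
  by (auto simp: mon_span_def keys_Var_mult image_subset_iff supp_add_single)

text \<open>Multiplication by \<open>x\<close> is injective on \<open>S/(x\<^sub>i : i \<in> V)\<close> if \<open>x \<notin> V\<close>; so the mapping cone of
  this multiplication resolves the quotient by one more variable.\<close>

lemma resolves_mod_vars_cone:
  fixes F :: "('n, 'k::comm_ring_1) free_complex"
  assumes F: "resolves_mod_vars V F" and x: "x \<notin> V"
  shows "resolves_mod_vars (insert x V) (cone x F)"
proof -
  let ?G = "cone x F"
  let ?T = "\<lambda>i. tensor_vecs F UNIV i"
  let ?J = "\<lambda>V. {u :: 'n expo. supp u \<inter> V \<noteq> {}}"
  have F0: "boundaries F UNIV 0 = {v \<in> ?T 0. v 0 \<in> mon_span (?J V)}"
    and ex: "\<And>i. cycles F UNIV (Suc i) = boundaries F UNIV (Suc i)"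
    and gr: "graded_diffs F" and rk: "rank F 0 = 1"
    using F by (auto simp: resolves_mod_vars_def simp del: cycles.simps)
  have dd: "diff_map F i (diff_map F (Suc i) a) = 0" if "a \<in> ?T (Suc (Suc i))" for i a
  proof -
    have "diff_map F (Suc i) a \<in> cycles F UNIV (Suc i)" unfolding ex boundaries_def using that by blast
    then show ?thesis by (simp add: zero_fun_def)
  qed
  have lin: "diff_map F i (\<lambda>k. diff_map F (Suc i) a k + Var x * c k) = (\<lambda>k. Var x * diff_map F i c k)"
    if "a \<in> ?T (Suc (Suc i))" for i a c
  proof -
    have "(\<lambda>k. diff_map F (Suc i) a k + Var x * c k) = diff_map F (Suc i) a + (\<lambda>k. Var x * c k)"
      by (rule ext) simp
    then show ?thesis by (simp add: diff_map_add diff_map_scale dd[OF that])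
  qed
  have T_neg: "- c \<in> ?T i" if "c \<in> ?T i" for c i using that by (simp add: tensor_vecs_UNIV)
  have cyc: "cycles ?G UNIV (Suc i) = boundaries ?G UNIV (Suc i)" for i
  proof
    show "boundaries ?G UNIV (Suc i) \<subseteq> cycles ?G UNIV (Suc i)"
    proof
      fix v assume "v \<in> boundaries ?G UNIV (Suc i)"
      then obtain w where w: "w \<in> tensor_vecs ?G UNIV (Suc (Suc i))" "v = diff_map ?G (Suc i) w"
        by (auto simp: boundaries_def)
      obtain a c where ac: "a \<in> ?T (Suc (Suc i))" "c \<in> ?T (Suc i)" "w = join (rank F (Suc (Suc i))) a c"
        using w(1) by (rule tensor_vecs_cone_cases)
      have v: "v = join (rank F (Suc i)) (\<lambda>k. diff_map F (Suc i) a k + Var x * c k) (- diff_map F i c)"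
        unfolding w(2) ac(3) diff_map_cone[OF ac(2)] by simp
      have "prev_diff F i (- diff_map F i c) = 0"
        using dd ac(2) by (cases i) (auto simp: diff_map_uminus)
      then have "diff_map ?G i v = 0"
        unfolding v diff_map_cone[OF T_neg[OF diff_map_in_tensor]] lin[OF ac(1)]
        by (simp add: join_def fun_eq_iff)
      then show "v \<in> cycles ?G UNIV (Suc i)"
        unfolding w(2) by (simp add: diff_map_in_tensor zero_fun_def)
    qed
    show "cycles ?G UNIV (Suc i) \<subseteq> boundaries ?G UNIV (Suc i)"
    proof
      fix v assume v: "v \<in> cycles ?G UNIV (Suc i)"
      then obtain a b where ab: "a \<in> ?T (Suc i)" "b \<in> ?T i" "v = join (rank F (Suc i)) a b"
        by (auto elim: tensor_vecs_cone_cases)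
      have "join (rank F i) (\<lambda>k. diff_map F i a k + Var x * b k) (- prev_diff F i b) = 0"
        using v unfolding ab(3) by (simp add: diff_map_cone[OF ab(2)] zero_fun_def)
      then have j: "join (rank F i) (\<lambda>k. diff_map F i a k + Var x * b k) (- prev_diff F i b) k = 0" for k
        by simp
      have eq: "diff_map F i a k + Var x * b k = 0" for k
        using j[of k] ab(2) diff_map_in_tensor[of F i a] by (cases "k < rank F i") (auto simp: join_def tensor_vecs_UNIV)
      have pd: "prev_diff F i b = 0"
      proof (rule ext)
        fix k show "prev_diff F i b k = 0 k" using j[of "rank F i + k"] by (simp add: join_def)
      qed
      \<comment> \<open>Here \<open>(a, b)\<close> is a cycle: \<open>d a + x b = 0\<close> and \<open>d b = 0\<close>. So \<open>b = d c\<close>, for \<open>i = 0\<close> because \<open>x b \<in> (x\<^sub>i : i \<in> V)\<close>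
        implies \<open>b \<in> (x\<^sub>i : i \<in> V)\<close>; then \<open>a + x c\<close> is a cycle \<open>d a'\<close>, and \<open>(a, b)\<close> is the boundary of \<open>(a', -c)\<close>.\<close>
      have "b \<in> boundaries F UNIV i"
      proof (cases i)
        case 0
        have "diff_map F 0 a \<in> boundaries F UNIV 0" using ab(1) 0 by (auto simp: boundaries_def)
        then have "diff_map F 0 a 0 \<in> mon_span (?J V)" using F0 by auto
        moreover have "Var x * b 0 = - diff_map F 0 a 0" using eq[of 0] 0 by (simp add: eq_neg_iff_add_eq_0 add.commute)
        ultimately have "Var x * b 0 \<in> mon_span (?J V)" by (simp add: mon_span_uminus)
        then have "b 0 \<in> mon_span (?J V)"
          using x by (simp add: Var_mult_in_mon_span_iff)
        then show ?thesis using ab(2) 0 F0 by simp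
      next
        case (Suc i')
        then have "b \<in> cycles F UNIV (Suc i')" using pd ab(2) by (simp add: zero_fun_def)
        then show ?thesis unfolding ex using Suc by simp
      qed
      then obtain c where c: "c \<in> ?T (Suc i)" "b = diff_map F i c" by (auto simp: boundaries_def)
      have "diff_map F i (a + (\<lambda>k. Var x * c k)) = 0"
        using eq by (simp add: diff_map_add diff_map_scale c(2) fun_eq_iff)
      moreover have "a + (\<lambda>k. Var x * c k) \<in> ?T (Suc i)" using ab(1) c(1) by (simp add: tensor_vecs_UNIV)
      ultimately have "a + (\<lambda>k. Var x * c k) \<in> cycles F UNIV (Suc i)" by (simp add: zero_fun_def)
      then obtain a' where a': "a' \<in> ?T (Suc (Suc i))" "a + (\<lambda>k. Var x * c k) = diff_map F (Suc i) a'"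
        unfolding ex by (auto simp: boundaries_def)
      have "diff_map F (Suc i) a' k + Var x * (- c) k = a k" for k
        by (simp flip: a'(2))
      then have "diff_map ?G (Suc i) (join (rank F (Suc (Suc i))) a' (- c)) = v"
        unfolding diff_map_cone[OF T_neg[OF c(1)]] ab(3) c(2) by (simp add: diff_map_uminus)
      then show "v \<in> boundaries ?G UNIV (Suc i)"
        using join_tensor_vecs[OF T_neg[OF c(1)], of a' x] by (auto simp: boundaries_def)
    qed
  qed
  have bd: "boundaries ?G UNIV 0 = {v \<in> tensor_vecs ?G UNIV 0. v 0 \<in> mon_span (?J (insert x V))}"
  proof
    have J: "?J V \<subseteq> ?J (insert x V)" by auto
    have xJ: "Var x * f \<in> mon_span (?J (insert x V))" for f :: "('n, 'k) mpoly"
      by (auto simp: mon_span_def keys_Var_mult supp_add_single)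
    show "boundaries ?G UNIV 0 \<subseteq> {v \<in> tensor_vecs ?G UNIV 0. v 0 \<in> mon_span (?J (insert x V))}"
    proof
      fix v assume "v \<in> boundaries ?G UNIV 0"
      then obtain w where w: "w \<in> tensor_vecs ?G UNIV (Suc 0)" "v = diff_map ?G 0 w"
        by (auto simp: boundaries_def)
      obtain a b where ab: "a \<in> ?T (Suc 0)" "b \<in> ?T 0" "w = join (rank F (Suc 0)) a b"
        using w(1) by (rule tensor_vecs_cone_cases)
      have "v 0 = diff_map F 0 a 0 + Var x * b 0"
        unfolding w(2) ab(3) diff_map_cone[OF ab(2)] by (simp add: join_def rk)
      moreover have "diff_map F 0 a \<in> boundaries F UNIV 0" using ab(1) by (auto simp: boundaries_def)
      then have "diff_map F 0 a 0 \<in> mon_span (?J (insert x V))" using F0 mon_span_mono[OF J] by blast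
      ultimately have "v 0 \<in> mon_span (?J (insert x V))" using xJ by (simp add: mon_span_add)
      then show "v \<in> {v \<in> tensor_vecs ?G UNIV 0. v 0 \<in> mon_span (?J (insert x V))}"
        unfolding w(2) using diff_map_in_tensor by blast
    qed
    show "{v \<in> tensor_vecs ?G UNIV 0. v 0 \<in> mon_span (?J (insert x V))} \<subseteq> boundaries ?G UNIV 0"
    proof
      fix v assume v: "v \<in> {v \<in> tensor_vecs ?G UNIV 0. v 0 \<in> mon_span (?J (insert x V))}"
      then have vT: "v k = 0" if "k \<ge> 1" for k using that by (simp add: tensor_vecs_UNIV rank_cone rk)
      have p: "restr (?J V) (v 0) \<in> mon_span (?J V)" by (auto simp: mon_span_def keys_restr)
      have "restr (- ?J V) (v 0) \<in> mon_span ((+) (Poly_Mapping.single x 1) ` UNIV)"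
      proof (rule mon_spanI, rule subsetI)
        fix u assume "u \<in> Poly_Mapping.keys (restr (- ?J V) (v 0))"
        then have "x \<in> supp u" using v by (auto simp: keys_restr mon_span_def)
        then show "u \<in> (+) (Poly_Mapping.single x 1) ` UNIV" using add_single_diff[of x u] by (metis rangeI)
      qed
      then obtain f where f: "restr (- ?J V) (v 0) = Var x * f"
        unfolding mon_span_translate Var_def by blast
      have "(\<lambda>k. if k = 0 then restr (?J V) (v 0) else 0) \<in> boundaries F UNIV 0"
        unfolding F0 using p by (simp add: tensor_vecs_UNIV rk)
      then obtain a where a: "a \<in> ?T (Suc 0)" "(\<lambda>k. if k = 0 then restr (?J V) (v 0) else 0) = diff_map F 0 a"
        by (auto simp: boundaries_def)
      let ?b = "\<lambda>k::nat. if k = 0 then f else 0"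
      have b: "?b \<in> ?T 0" by (simp add: tensor_vecs_UNIV rk)
      have "diff_map ?G 0 (join (rank F (Suc 0)) a ?b) = v"
        unfolding diff_map_cone[OF b] a(2)[symmetric]
        using restr_add_compl[of "?J V" "v 0"] vT by (auto simp: join_def rk f fun_eq_iff)
      then show "v \<in> boundaries ?G UNIV 0"
        using join_tensor_vecs[OF b, of a x] by (auto simp: boundaries_def)
    qed
  qed
  show ?thesis
    unfolding resolves_mod_vars_def bd using F cyc graded_diffs_cone[OF gr]
    by (auto simp: resolves_mod_vars_def cone_def simp del: cycles.simps)
qed

theorem graded_free_resolution_of_K_exists:
  "\<exists>F :: ('n::finite, 'k::comm_ring_1) free_complex. graded_free_resolution_of_K F"
proof -
  have "\<exists>F :: ('n, 'k) free_complex. resolves_mod_vars V F" for V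
    using finite[of V]
  proof (induction V)
    case empty
    show ?case by (rule resolves_mod_vars_empty)
  next
    case (insert x V)
    then obtain F :: "('n, 'k) free_complex" where "resolves_mod_vars V F" by blast
    then have "resolves_mod_vars (insert x V) (cone x F)" using insert.hyps(2) by (rule resolves_mod_vars_cone)
    then show ?case by blast
  qed
  from this[of UNIV] obtain F :: "('n, 'k) free_complex" where F: "resolves_mod_vars UNIV F" ..
  then have r: "rank F 0 = 1" "shift F 0 0 = 0" "aug F 0 = 1"
    unfolding resolves_mod_vars_def by blast+
  have "f \<in> mon_span {u. supp u \<inter> UNIV \<noteq> {}} \<longleftrightarrow> Poly_Mapping.lookup f 0 = 0" for f :: "('n, 'k) mpoly"
  proof -
    have "supp u \<noteq> {} \<longleftrightarrow> u \<noteq> 0" for u :: "'n expo" by (simp add: supp_def)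
    then show ?thesis by (auto simp: mon_span_def in_keys_iff)
  qed
  then have 0: "{v \<in> tensor_vecs F UNIV 0. Poly_Mapping.lookup (v 0) 0 = 0} = boundaries F UNIV 0"
    using F unfolding resolves_mod_vars_def by simp
  have surj: "\<exists>v\<in>tensor_vecs F UNIV 0. Poly_Mapping.lookup (v 0) 0 = a" for a
    by (rule bexI[of _ "\<lambda>k. if k = 0 then Poly_Mapping.single 0 a else 0"]) (auto simp: tensor_vecs_UNIV r)
  have "graded_free_resolution_of_K F"
    unfolding graded_free_resolution_of_K_def graded_diffs_def[symmetric]
    using F 0 surj by (simp add: r resolves_mod_vars_def del: cycles.simps)
  then show ?thesis by blast
qed

section \<open>Families of subsets with few missing members\<close>

definition subsets_of_card :: "'a set \<Rightarrow> nat \<Rightarrow> 'a set set"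
  where "subsets_of_card V d = {T. T \<subseteq> V \<and> card T = d}"

definition missing :: "'a set \<Rightarrow> nat \<Rightarrow> 'a set set \<Rightarrow> 'a set set"
  where "missing V d X = subsets_of_card V d - X"

lemma finite_subsets_of_card: "finite V \<Longrightarrow> finite (subsets_of_card V d)"
  by (simp add: subsets_of_card_def)

lemma finite_missing: "finite V \<Longrightarrow> finite (missing V d X)"
  by (simp add: missing_def finite_subsets_of_card)

lemma card_subsets_of_card: "finite V \<Longrightarrow> card (subsets_of_card V d) = card V choose d"
  by (simp add: subsets_of_card_def n_subsets)

lemma card_missing:
  assumes "finite V" "X \<subseteq> subsets_of_card V d"
  shows "card (missing V d X) + card X = card V choose d"
proof -
  have "finite X" using assms finite_subsets_of_card finite_subset by blast
  then show ?thesis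
    using assms card_mono[OF finite_subsets_of_card[OF assms(1)] assms(2)]
    by (simp add: missing_def card_Diff_subset card_subsets_of_card)
qed

lemma exchange_subset_card:
  assumes "finite V" "T \<in> subsets_of_card V d" "i \<in> V" "i \<notin> T" "j \<in> T"
  shows "insert i (T - {j}) \<in> subsets_of_card V d"
proof -
  have "finite T" using assms finite_subset by (auto simp: subsets_of_card_def)
  then have "card T = card (insert i (T - {j}))" using assms card.remove[of T j] by simp
  then show ?thesis using assms by (auto simp: subsets_of_card_def)
qed

lemma card_exchanges:
  assumes "finite T" "i \<notin> T"
  shows "card ((\<lambda>j. insert i (T - {j})) ` T) = card T"
proof (rule card_image, rule inj_onI)
  fix j k assume "j \<in> T" "k \<in> T" "insert i (T - {j}) = insert i (T - {k})"
  then have "T - {j} = T - {k}" using assms(2) by (metis Diff_insert_absorb Diff_iff)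
  then show "j = k" using \<open>j \<in> T\<close> by blast
qed

lemma sum_card_containing:
  assumes "finite V" "M \<subseteq> subsets_of_card V d"
  shows "(\<Sum>i\<in>V. card {T \<in> M. i \<in> T}) = d * card M"
proof -
  have M: "finite M" using assms finite_subsets_of_card finite_subset by blast
  have "(\<Sum>i\<in>V. card {T \<in> M. i \<in> T}) = (\<Sum>T\<in>M. d)"
  proof (rule sum_multicount_gen[OF assms(1) M], intro ballI)
    fix T assume "T \<in> M"
    then have "{i \<in> V. i \<in> T} = T" "card T = d" using assms(2) by (auto simp: subsets_of_card_def)
    then show "card {i \<in> V. i \<in> T} = d" by simp
  qed
  then show ?thesis by simp
qed

text \<open>The vertex \<open>i\<close> must satisfy two conditions. Few missing sets contain \<open>i\<close>, so that the link of \<open>i\<close> is again a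
  family with few missing sets, of size \<open>d - 1\<close>. And each member \<open>T\<close> of the family avoiding \<open>i\<close> contains a
  member of the link, so that \<open>I\<^sub>2 \<subseteq> I\<^sub>1\<close>; call \<open>i\<close> an apex if some \<open>T\<close> violates this. All \<open>d\<close> sets
  \<open>T - {j} \<union> {i}\<close> are then missing, so an apex lies in at least \<open>d\<close> missing sets.

  A vertex in fewer than \<open>d\<close> missing sets is therefore as desired. Otherwise all vertices lie in at
  least \<open>d\<close> missing sets. Then there are at least \<open>d + 2\<close> vertices: on \<open>d + 1\<close> vertices there are only \<open>d + 1\<close> sets
  of size \<open>d\<close>, of which at least two belong to the family. There is no apex \<open>i\<close> for any \<open>T\<close>, since the \<open>d\<close> missing sets that it yields
  leave at most \<open>d - 1\<close> missing sets for a vertex outside \<open>T \<union> {i}\<close>. Finally, double counting of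
  the pairs of a missing set and a vertex in it gives a vertex in at most \<open>2d - 3\<close> missing sets. For \<open>d = 1\<close> the
  truncated bound in the first condition is \<open>0\<close>.\<close>

lemma exists_splitting_vertex:
  assumes V: "finite V" and X: "X \<subseteq> subsets_of_card V d" and M: "card (missing V d X) \<le> 2 * d - 1"
    and X2: "\<not> card X \<le> 1"
  obtains i where "i \<in> V" "card {T \<in> missing V d X. i \<in> T} \<le> 2 * (d - 1) - 1"
    "\<And>T. T \<in> X \<Longrightarrow> i \<notin> T \<Longrightarrow> \<exists>j\<in>T. insert i (T - {j}) \<in> X"
proof -
  let ?M = "missing V d X" and ?m = "\<lambda>i. card {T \<in> missing V d X. i \<in> T}"
  have Mfin: "finite ?M" using V by (rule finite_missing)
  have Xfin: "finite X" using X V finite_subsets_of_card finite_subset by blast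
  obtain T1 T2 where T12: "T1 \<in> X" "T2 \<in> X" "T1 \<noteq> T2"
    using X2 card_le_Suc0_iff_eq[OF Xfin] by auto
  have cT: "T \<subseteq> V" "card T = d" if "T \<in> X" for T using that X by (auto simp: subsets_of_card_def)
  have fin: "finite T" if "T \<in> X" for T using cT(1)[OF that] V by (rule finite_subset)
  have d: "d \<ge> 1"
  proof (rule ccontr)
    assume "\<not> d \<ge> 1"
    then have "card T1 = 0" "card T2 = 0" using cT(2) T12 by auto
    then have "T1 = {}" "T2 = {}" using fin T12 by auto
    then show False using T12(3) by simp
  qed
  have n: "card V \<ge> d + 1"
  proof -
    obtain p where "p \<in> T2" "p \<notin> T1"
      using T12 cT fin by (metis card_subset_eq subsetI)
    then have "card (insert p T1) = d + 1" "insert p T1 \<subseteq> V" using T12 cT[of T1] cT[of T2] fin[of T1] by auto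
    then show ?thesis using card_mono[OF V, of "insert p T1"] by simp
  qed
  have exch: "(\<lambda>j. insert i (T - {j})) ` T \<subseteq> {S \<in> ?M. i \<in> S}"
    if "i \<in> V" "T \<in> X" "i \<notin> T" "\<forall>j\<in>T. insert i (T - {j}) \<notin> X" for i T
    using that X exchange_subset_card[OF V _ that(1) that(3)] by (auto simp: missing_def)
  have apex: "\<exists>j\<in>T. insert i (T - {j}) \<in> X" if "i \<in> V" "?m i < d" "T \<in> X" "i \<notin> T" for i T
  proof (rule ccontr)
    assume *: "\<not> ?thesis"
    then have "d \<le> ?m i"
      using card_mono[OF _ exch[OF that(1,3,4)]] Mfin card_exchanges[OF fin[OF that(3)] that(4)] cT[OF that(3)] by auto
    then show False using that by simp
  qed
  show thesis
  proof (cases "\<exists>i\<in>V. ?m i < d")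
    case True
    then obtain i where "i \<in> V" "?m i < d" by blast
    moreover from this have "?m i \<le> 2 * (d - 1) - 1" by arith
    ultimately show thesis using that apex by blast
  next
    case False
    then have ge: "?m i \<ge> d" if "i \<in> V" for i using that by (meson not_less)
    have le: "?m i \<le> card ?M" for i using Mfin by (intro card_mono) auto
    have d2: "d \<ge> 2"
    proof (rule ccontr)
      assume "\<not> d \<ge> 2"
      then have "card T1 = 1" using T12 cT d by auto
      then obtain p where p: "T1 = {p}" using card_1_singletonE by blast
      have "{T \<in> ?M. p \<in> T} = {}"
      proof (rule ccontr)
        assume "{T \<in> ?M. p \<in> T} \<noteq> {}"
        then obtain T where T: "T \<in> ?M" "p \<in> T" by blast
        then have "card T = 1" using \<open>card T1 = 1\<close> cT(2)[OF T12(1)] by (auto simp: missing_def subsets_of_card_def)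
        then have "T = {p}" using T(2) by (metis card_1_singletonE singletonD)
        then show False using T T12 p by (auto simp: missing_def)
      qed
      then have "?m p = 0" by (simp only: card.empty)
      then show False using ge[of p] p cT(1)[OF T12(1)] d by auto
    qed
    have n2: "card V \<ge> d + 2"
    proof (rule ccontr)
      assume "\<not> card V \<ge> d + 2"
      then have "card V = Suc d" using n by simp
      then have "card ?M + card X = Suc d" using card_missing[OF V X] by simp
      then have "card ?M < d" using X2 by simp
      moreover obtain i where "i \<in> V" using n by fastforce
      ultimately show False using ge[of i] le[of i] by simp
    qed
    have not_apex: "\<exists>j\<in>T. insert i (T - {j}) \<in> X" if "i \<in> V" "T \<in> X" "i \<notin> T" for i T
    proof (rule ccontr)
      assume "\<not> ?thesis"
      then have sub: "(\<lambda>j. insert i (T - {j})) ` T \<subseteq> {S \<in> ?M. i \<in> S}" (is "?E \<subseteq> _")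
        using exch[OF that] by blast
      have E: "card ?E = d" using card_exchanges[OF fin[OF that(2)] that(3)] cT[OF that(2)] by simp
      have "card (insert i T) < card V" using n2 cT(2)[OF that(2)] fin[OF that(2)] that(3) by simp
      then obtain k where k: "k \<in> V" "k \<notin> insert i T"
        using card_mono[of "insert i T" V] fin[OF \<open>T \<in> X\<close>] by fastforce
      have "{S \<in> ?M. k \<in> S} \<subseteq> ?M - ?E" using k by auto
      then have "?m k \<le> card (?M - ?E)" using Mfin by (intro card_mono) auto
      also have "\<dots> = card ?M - d"
        using sub E fin[OF that(2)] by (subst card_Diff_subset) auto
      finally show False using ge[OF k(1)] M d by simp
    qed
    have "\<exists>i\<in>V. ?m i \<le> 2 * (d - 1) - 1"
    proof (rule ccontr)
      assume "\<not> ?thesis"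
      then have "2 * d - 2 \<le> ?m i" if "i \<in> V" for i using that by fastforce
      then have "card V * (2 * d - 2) \<le> (\<Sum>i\<in>V. ?m i)" using sum_bounded_below[of V "2 * d - 2" ?m] by simp
      also have "\<dots> = d * card ?M" by (rule sum_card_containing[OF V]) (auto simp: missing_def)
      also have "\<dots> \<le> d * (2 * d - 1)" using M by simp
      finally have "(d + 2) * (2 * d - 2) \<le> d * (2 * d - 1)"
        using mult_le_mono1[OF n2, of "2 * d - 2"] by linarith
      moreover obtain k where "d = k + 2" using d2 by (metis add.commute le_Suc_ex)
      ultimately show False by (simp add: algebra_simps)
    qed
    then show thesis using that not_apex by blast
  qed
qed

definition shadow :: "'a set set \<Rightarrow> 'a set set"
  where "shadow X = {T - {i} | T i. T \<in> X \<and> i \<in> T}"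

lemma shadow_subset:
  assumes "finite V" "X \<subseteq> subsets_of_card V d"
  shows "shadow X \<subseteq> subsets_of_card V (d - 1)"
  using assms finite_subset by (fastforce simp: shadow_def subsets_of_card_def)

text \<open>A \<open>(d-1)\<close>-subset is missing from the shadow only if all its \<open>n - d + 1\<close> supersets of size \<open>d\<close>
  are missing from the family, and two \<open>(d-1)\<close>-subsets share at most one such superset.\<close>

lemma card_missing_shadow:
  assumes V: "finite V" and X: "X \<subseteq> subsets_of_card V d" and M: "card (missing V d X) \<le> 2 * d - 1"
    and n: "2 * d \<le> card V" and d: "d \<ge> 1"
  shows "card (missing V (d - 1) (shadow X)) \<le> 1"
proof -
  let ?M = "missing V d X" and ?N = "missing V (d - 1) (shadow X)"
  define up where "up R = (\<lambda>k. insert k R) ` (V - R)" for R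
  have Mfin: "finite ?M" using V by (rule finite_missing)
  have R: "R \<subseteq> V" "card R = d - 1" "R \<notin> shadow X" "finite R" if "R \<in> ?N" for R
    using that V finite_subset by (auto simp: missing_def subsets_of_card_def)
  have up_sub: "up R \<subseteq> ?M" if "R \<in> ?N" for R
  proof
    fix S assume "S \<in> up R"
    then obtain k where k: "k \<in> V" "k \<notin> R" "S = insert k R" by (auto simp: up_def)
    have "S \<notin> X"
    proof
      assume "S \<in> X"
      moreover have "R = S - {k}" "k \<in> S" using k by auto
      ultimately have "R \<in> shadow X" unfolding shadow_def by blast
      then show False using R[OF that] by simp
    qed
    then show "S \<in> ?M" using k R[OF that] d by (simp add: missing_def subsets_of_card_def)
  qed
  have up_card: "card (up R) = card V - (d - 1)" if "R \<in> ?N" for R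
  proof -
    have "inj_on (\<lambda>k. insert k R) (V - R)" by (rule inj_onI) blast
    then show ?thesis using R[OF that] V by (simp add: up_def card_image card_Diff_subset)
  qed
  have "R1 = R2" if R12: "R1 \<in> ?N" "R2 \<in> ?N" for R1 R2
  proof (rule ccontr)
    assume ne: "R1 \<noteq> R2"
    have "up R1 \<inter> up R2 \<subseteq> {R1 \<union> R2}"
    proof
      fix S assume "S \<in> up R1 \<inter> up R2"
      then obtain k l where kl: "k \<notin> R1" "l \<notin> R2" "S = insert k R1" "S = insert l R2" by (auto simp: up_def)
      then have "k \<noteq> l" using ne by (metis Diff_insert_absorb)
      then have "k \<in> R2" using kl by blast
      then show "S \<in> {R1 \<union> R2}" using kl by blast
    qed
    then have "card (up R1 \<inter> up R2) \<le> 1" using card_mono[of "{R1 \<union> R2}"] by force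
    moreover have "card (up R1 \<union> up R2) \<le> card ?M" using up_sub R12 by (intro card_mono[OF Mfin]) blast
    moreover have "card (up R1) + card (up R2) = card (up R1 \<union> up R2) + card (up R1 \<inter> up R2)"
      using V by (intro card_Un_Int) (auto simp: up_def)
    ultimately show False using up_card[OF R12(1)] up_card[OF R12(2)] M n d by linarith
  qed
  then show ?thesis using card_le_Suc0_iff_eq[OF finite_missing[OF V]] by auto
qed

section \<open>Squarefree monomial ideals with few missing generators\<close>

definition sqfree_expo :: "'n set \<Rightarrow> 'n expo"
  where "sqfree_expo T = (\<Sum>i\<in>T. Poly_Mapping.single i 1)"

lemma lookup_sqfree_expo:
  fixes T :: "'n::finite set"
  shows "Poly_Mapping.lookup (sqfree_expo T) i = (if i \<in> T then 1 else 0)"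
  by (simp add: sqfree_expo_def lookup_sum lookup_single when_def)

lemma supp_sqfree_expo:
  fixes T :: "'n::finite set"
  shows "supp (sqfree_expo T) = T"
  by (auto simp: supp_def in_keys_iff lookup_sqfree_expo split: if_splits)

lemma mdeg_sqfree_expo:
  fixes T :: "'n::finite set"
  shows "mdeg (sqfree_expo T) = card T"
  by (simp add: mdeg_def supp_sqfree_expo lookup_sqfree_expo)

lemma sqfree_expo_remove:
  fixes T :: "'n::finite set"
  assumes "i \<in> T"
  shows "sqfree_expo T = Poly_Mapping.single i 1 + sqfree_expo (T - {i})"
  unfolding sqfree_expo_def by (rule sum.remove) (use assms in auto)

definition sqfree_ideal :: "'n set set \<Rightarrow> ('n, 'k::comm_ring_1) mpoly set"
  where "sqfree_ideal X = ideal_gen (mon ` sqfree_expo ` X)"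

text \<open>Splitting at the vertex found above leads to the link and the deletion of that vertex, to which the
  induction hypothesis applies, both on one vertex less. The bound on the
  missing sets does not mention the number of vertices, so it survives the deletion.\<close>

theorem vertex_splittable_in_few_missing:
  fixes V :: "'n::finite set"
  assumes "X \<subseteq> subsets_of_card V d" "card (missing V d X) \<le> 2 * d - 1"
  shows "vertex_splittable_in V (sqfree_ideal X :: ('n, 'k::comm_ring_1) mpoly set)"
  using finite[of V] assms
proof (induction V arbitrary: X d rule: finite_psubset_induct)
  case (psubset V)
  show ?case
  proof (cases "card X \<le> 1")
    case True
    have "finite X" using finite_subset by simp
    then consider "X = {}" | T where "X = {T}"
      using True by (metis One_nat_def card_1_singletonE card_0_eq le_SucE le_zero_eq)
    then show ?thesis
    proof cases
      case 1
      then show ?thesis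
        using vertex_splittable_in.zero by (simp add: sqfree_ideal_def ideal_gen_def)
    next
      case 2
      then have "supp (sqfree_expo T) \<subseteq> V"
        using psubset.prems(1) by (auto simp: supp_sqfree_expo subsets_of_card_def)
      then show ?thesis
        using 2 vertex_splittable_in.principal by (simp add: sqfree_ideal_def)
    qed
  next
    case False
    obtain i where i: "i \<in> V" "card {T \<in> missing V d X. i \<in> T} \<le> 2 * (d - 1) - 1"
      "\<And>T. T \<in> X \<Longrightarrow> i \<notin> T \<Longrightarrow> \<exists>j\<in>T. insert i (T - {j}) \<in> X"
      using exists_splitting_vertex[OF psubset.hyps psubset.prems False] by blast
    define L where "L = {T. i \<notin> T \<and> insert i T \<in> X}"
    define D where "D = {T \<in> X. i \<notin> T}"
    have Xd: "T \<subseteq> V" "card T = d" if "T \<in> X" for T using that psubset.prems(1) by (auto simp: subsets_of_card_def)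
    have d: "d \<ge> 1"
    proof (rule ccontr)
      assume "\<not> d \<ge> 1"
      then have "card T = 0" if "T \<in> X" for T using Xd(2)[OF that] by simp
      then have "T = {}" if "T \<in> X" for T using that by simp
      then have "X \<subseteq> {{}}" by blast
      then show False using False card_mono[of "{{}}" X] by simp
    qed
    have L: "L \<subseteq> subsets_of_card (V - {i}) (d - 1)"
      using Xd by (fastforce simp: L_def subsets_of_card_def)
    have D: "D \<subseteq> subsets_of_card (V - {i}) d"
      using Xd by (auto simp: D_def subsets_of_card_def)
    have "card (missing (V - {i}) (d - 1) L) = card (insert i ` missing (V - {i}) (d - 1) L)"
      by (rule card_image[symmetric], rule inj_onI)
         (auto simp: missing_def subsets_of_card_def)
    also have "\<dots> \<le> card {T \<in> missing V d X. i \<in> T}"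
    proof (rule card_mono)
      show "finite {T \<in> missing V d X. i \<in> T}" by simp
      have "insert i T \<in> missing V d X" if "T \<in> missing (V - {i}) (d - 1) L" for T
      proof -
        have "i \<notin> T" "T \<subseteq> V" "card T = d - 1" "T \<notin> L" using that by (auto simp: missing_def subsets_of_card_def)
        then show ?thesis using i(1) d by (simp add: missing_def subsets_of_card_def L_def)
      qed
      then show "insert i ` missing (V - {i}) (d - 1) L \<subseteq> {T \<in> missing V d X. i \<in> T}" by blast
    qed
    finally have mL: "card (missing (V - {i}) (d - 1) L) \<le> 2 * (d - 1) - 1" using i(2) by simp
    have "missing (V - {i}) d D \<subseteq> missing V d X" by (auto simp: missing_def subsets_of_card_def D_def)
    then have "card (missing (V - {i}) d D) \<le> card (missing V d X)" by (intro card_mono) auto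
    then have mD: "card (missing (V - {i}) d D) \<le> 2 * d - 1" using psubset.prems(2) by simp
    have Vi: "V - {i} \<subset> V" using i(1) by blast
    have vL: "vertex_splittable_in V (sqfree_ideal L :: ('n, 'k) mpoly set)"
      using psubset.IH[OF Vi L mL] by (rule vertex_splittable_in_mono) blast
    have vD: "vertex_splittable_in (V - {i}) (sqfree_ideal D :: ('n, 'k) mpoly set)"
      by (rule psubset.IH[OF Vi D mD])
    have "sqfree_expo ` X = (+) (Poly_Mapping.single i 1) ` sqfree_expo ` L \<union> sqfree_expo ` D" (is "_ = ?R")
    proof
      show "sqfree_expo ` X \<subseteq> ?R"
      proof
        fix u assume "u \<in> sqfree_expo ` X"
        then obtain T where T: "T \<in> X" "u = sqfree_expo T" by blast
        show "u \<in> ?R"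
        proof (cases "i \<in> T")
          case True
          then have "T - {i} \<in> L" using T(1) by (simp add: L_def insert_absorb)
          then show ?thesis using sqfree_expo_remove[OF True] T(2) by blast
        next
          case False
          then show ?thesis using T by (auto simp: D_def)
        qed
      qed
      show "?R \<subseteq> sqfree_expo ` X"
      proof -
        have "Poly_Mapping.single i 1 + sqfree_expo T \<in> sqfree_expo ` X" if "T \<in> L" for T
        proof -
          have "i \<notin> T" "insert i T \<in> X" using that by (auto simp: L_def)
          then show ?thesis using sqfree_expo_remove[of i "insert i T"] by (metis Diff_insert_absorb imageI insertI1)
        qed
        then show ?thesis by (auto simp: D_def)
      qed
    qed
    moreover have "vertex_splittable_in V (ideal_gen (mon ` ?R) :: ('n, 'k) mpoly set)"
    proof (rule vertex_splittable_in_splitI[OF i(1)])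
      show "sqfree_expo ` D \<subseteq> multiples (sqfree_expo ` L)"
      proof
        fix u assume "u \<in> sqfree_expo ` D"
        then obtain T where T: "T \<in> X" "i \<notin> T" "u = sqfree_expo T" by (auto simp: D_def)
        then obtain j where j: "j \<in> T" "insert i (T - {j}) \<in> X" using i(3) by blast
        then have "T - {j} \<in> L" using T(2) by (simp add: L_def)
        then show "u \<in> multiples (sqfree_expo ` L)"
          using sqfree_expo_remove[OF j(1)] T(3) by (metis add.commute imageI multiplesI)
      qed
      show "mdeg b = d - 1" if "b \<in> sqfree_expo ` L" for b
        using that L by (auto simp: mdeg_sqfree_expo subsets_of_card_def)
      show "mdeg c = Suc (d - 1)" if "c \<in> sqfree_expo ` D" for c
        using that D d by (auto simp: mdeg_sqfree_expo subsets_of_card_def)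
      show "i \<notin> supp c" if "c \<in> sqfree_expo ` D" for c
        using that by (auto simp: supp_sqfree_expo D_def)
    qed (use vL vD in \<open>simp_all add: sqfree_ideal_def\<close>)
    ultimately show ?thesis by (simp add: sqfree_ideal_def)
  qed
qed

section \<open>Gradient ideals of equigenerated monomial ideals\<close>

text \<open>Exponent vectors \<open>u\<close> with \<open>u\<^sub>i = 0\<close> are left fixed by the truncated subtraction in \<open>partial_deriv\<close>, but
  their coefficients are annihilated.\<close>

lemma lookup_partial_deriv:
  fixes f :: "('n, 'k::comm_ring_1) mpoly"
  shows "Poly_Mapping.lookup (partial_deriv i f) w
    = of_nat (Poly_Mapping.lookup w i + 1) * Poly_Mapping.lookup f (w + Poly_Mapping.single i 1)"
proof -
  let ?s = "Poly_Mapping.single i (1::nat)"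
  have "Poly_Mapping.lookup (partial_deriv i f) w = (\<Sum>u\<in>Poly_Mapping.keys f.
      (of_nat (Poly_Mapping.lookup u i) * Poly_Mapping.lookup f u when u - ?s = w))"
    by (simp add: partial_deriv_def lookup_sum lookup_single)
  also have "\<dots> = (\<Sum>u\<in>Poly_Mapping.keys f.
      if u = w + ?s then of_nat (Poly_Mapping.lookup u i) * Poly_Mapping.lookup f u else 0)"
  proof (rule sum.cong[OF refl])
    fix u :: "'n expo"
    show "(of_nat (Poly_Mapping.lookup u i) * Poly_Mapping.lookup f u when u - ?s = w)
        = (if u = w + ?s then of_nat (Poly_Mapping.lookup u i) * Poly_Mapping.lookup f u else 0)"
    proof (cases "Poly_Mapping.lookup u i = 0")
      case True
      then show ?thesis by (auto simp: when_def)
    next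
      case False
      then have "?s + (u - ?s) = u" by (intro add_single_diff) (simp add: supp_def in_keys_iff)
      then have "u - ?s = w \<longleftrightarrow> u = w + ?s" by (metis add.commute add_diff_cancel_right')
      then show ?thesis by (simp add: when_def)
    qed
  qed
  also have "\<dots> = of_nat (Poly_Mapping.lookup (w + ?s) i) * Poly_Mapping.lookup f (w + ?s)"
    by (simp add: in_keys_iff)
  finally show ?thesis by (simp add: lookup_add)
qed

lemma partial_deriv_0 [simp]: "partial_deriv i 0 = 0"
  by (simp add: partial_deriv_def)

lemma partial_deriv_add: "partial_deriv i (f + g) = partial_deriv i f + partial_deriv i g"
  by (rule poly_mapping_eqI) (simp only: lookup_partial_deriv lookup_add distrib_left)

lemma partial_deriv_Const_mult:
  "partial_deriv i (Poly_Mapping.single 0 c * f) = Poly_Mapping.single 0 c * partial_deriv i f"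
  by (rule poly_mapping_eqI) (simp only: lookup_partial_deriv lookup_single_0_mult mult.left_commute)

lemma partial_deriv_mon:
  "partial_deriv i (mon u) = Poly_Mapping.single (u - Poly_Mapping.single i 1) (of_nat (Poly_Mapping.lookup u i))"
  by (simp add: partial_deriv_def mon_def)

definition grad_exps :: "'n expo set \<Rightarrow> 'n expo set"
  where "grad_exps A = {u - Poly_Mapping.single i 1 | u i. u \<in> A \<and> i \<in> supp u}"

text \<open>A derivative either lowers the generator that divides a monomial, or the cofactor; in the second
  case the result still lies in \<open>I\<close>, and \<open>I\<close> is contained in the ideal generated by the derivatives of
  its monomial generators since these are not constant.\<close>

lemma partial_deriv_in_mon_span:
  fixes f :: "('n, 'k::comm_ring_1) mpoly"
  assumes f: "f \<in> mon_span (multiples A)" and A: "\<And>a. a \<in> A \<Longrightarrow> a \<noteq> 0"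
  shows "partial_deriv i f \<in> mon_span (multiples (grad_exps A))"
proof (rule mon_spanI, rule subsetI)
  let ?s = "\<lambda>i. Poly_Mapping.single i (1::nat)"
  fix w assume "w \<in> Poly_Mapping.keys (partial_deriv i f)"
  then have "w + ?s i \<in> Poly_Mapping.keys f"
    using lookup_partial_deriv[of i f w] by (auto simp: in_keys_iff)
  then have "w + ?s i \<in> multiples A" using mon_spanD[OF f] by blast
  then obtain a v where a: "a \<in> A" and av: "w + ?s i = a + v" by (rule multiplesE)
  show "w \<in> multiples (grad_exps A)"
  proof (cases "i \<in> supp a")
    case True
    then have "?s i + (a - ?s i) = a" by (rule add_single_diff)
    then have "w + ?s i = ((a - ?s i) + v) + ?s i" using av by (metis add.assoc add.commute)
    then have "w = (a - ?s i) + v" by simp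
    moreover have "a - ?s i \<in> grad_exps A" using a True by (auto simp: grad_exps_def)
    ultimately show ?thesis by (simp add: multiplesI)
  next
    case False
    have "Poly_Mapping.lookup (w + ?s i) i = Poly_Mapping.lookup (a + v) i" using av by simp
    then have "i \<in> supp v" using False by (auto simp: lookup_add supp_def in_keys_iff)
    then have "?s i + (v - ?s i) = v" by (rule add_single_diff)
    then have "w + ?s i = (a + (v - ?s i)) + ?s i" using av by (metis add.assoc add.commute)
    then have w: "w = a + (v - ?s i)" by simp
    obtain k where k: "k \<in> supp a" using A[OF a] by (metis equals0I keys_eq_empty supp_def)
    then have "a - ?s k \<in> grad_exps A" using a by (auto simp: grad_exps_def)
    moreover have "a = (a - ?s k) + ?s k" using add_single_diff[OF k] by (simp add: add.commute)
    ultimately have "a \<in> multiples (grad_exps A)" by (metis multiplesI)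
    then show ?thesis unfolding w by (rule multiples_add)
  qed
qed

text \<open>In the lowest degree of an ideal, ideal combinations are linear combinations over \<open>K\<close>.\<close>

lemma hcomp_mult_initial_degree:
  fixes c b :: "('n, 'k::comm_ring_1) mpoly"
  assumes "\<And>w. w \<in> Poly_Mapping.keys b \<Longrightarrow> e \<le> mdeg w"
  shows "hcomp (int e) (c * b) = Poly_Mapping.single 0 (Poly_Mapping.lookup c 0) * hcomp (int e) b"
proof (rule poly_mapping_eqI)
  fix w
  have "Poly_Mapping.lookup (c * b) w = Poly_Mapping.lookup c 0 * Poly_Mapping.lookup b w" if "mdeg w = e"
    by (rule lookup_mult_initial_degree) (use assms that in auto)
  then show "Poly_Mapping.lookup (hcomp (int e) (c * b)) w
      = Poly_Mapping.lookup (Poly_Mapping.single 0 (Poly_Mapping.lookup c 0) * hcomp (int e) b) w"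
    by (simp add: hcomp_def lookup_restr lookup_single_0_mult)
qed

text \<open>In characteristic \<open>0\<close> the gradient ideal does not depend on the homogeneous generators \<open>B\<close>: each of the
  monomial generators \<open>u\<close> lies in the lowest degree of the ideal and is therefore a \<open>K\<close>-linear combination of elements of
  \<open>B\<close>, so \<open>\<partial>u/\<partial>x\<^sub>i\<close> is a \<open>K\<close>-linear combination of their derivatives, and its coefficient \<open>u\<^sub>i\<close> is invertible.\<close>

lemma ideal_gen_partial_derivs:
  fixes B :: "('n, 'k::field) mpoly set"
  assumes A: "\<And>a. a \<in> A \<Longrightarrow> mdeg a = Suc e" and char: "CHAR('k) = 0"
    and hom: "\<forall>f\<in>B. homogeneous f" and B: "ideal_gen B = ideal_gen (mon ` A)"
  shows "ideal_gen {partial_deriv i f | i f. f \<in> B} = ideal_gen (mon ` grad_exps A)"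
proof
  have BJ: "B \<subseteq> mon_span (multiples A)"
    using B ideal.span_superset[of B] by (auto simp: ideal_gen_def simp flip: ideal_gen_mon)
  have A0: "a \<noteq> 0" if "a \<in> A" for a using A[OF that] by auto
  show "ideal_gen {partial_deriv i f | i f. f \<in> B} \<subseteq> ideal_gen (mon ` grad_exps A)"
    unfolding ideal_gen_mon unfolding ideal_gen_def
  proof (rule ideal.span_minimal)
    show "{partial_deriv i f | i f. f \<in> B} \<subseteq> mon_span (multiples (grad_exps A))"
      using partial_deriv_in_mon_span[OF subsetD[OF BJ] A0] by auto
    show "ideal.subspace (mon_span (multiples (grad_exps A)) :: ('n, 'k) mpoly set)"
      by (auto simp: ideal.subspace_def intro: mon_span_add mon_span_mult)
  qed
  let ?G = "ideal_gen {partial_deriv i f | i f. f \<in> B}"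
  have lowest: "partial_deriv i (hcomp (int (Suc e)) f) \<in> ?G" if "f \<in> ideal_gen B" for f i
    using that unfolding ideal_gen_def
  proof (induction rule: ideal.span_induct_alt)
    case base
    show ?case by (simp add: hcomp_def ideal.span_zero)
  next
    case (step c b f)
    have "Suc e \<le> mdeg w" if "w \<in> Poly_Mapping.keys b" for w
      using that BJ step.hyps A by (fastforce simp: mon_span_def mdeg_add elim!: multiplesE)
    then have "hcomp (int (Suc e)) (c * b + f)
        = Poly_Mapping.single 0 (Poly_Mapping.lookup c 0) * hcomp (int (Suc e)) b + hcomp (int (Suc e)) f"
      using hcomp_mult_initial_degree[of b "Suc e" c] by (simp add: hcomp_def restr_add)
    moreover have "partial_deriv i (hcomp (int (Suc e)) b) \<in> ideal.span {partial_deriv i f | i f. f \<in> B}"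
    proof -
      obtain e' where e': "homogeneous_deg e' b" using hom step.hyps by (auto simp: homogeneous_def)
      consider "hcomp (int (Suc e)) b = b" | "hcomp (int (Suc e)) b = 0"
      proof (cases "e' = int (Suc e)")
        case True
        then show ?thesis using that e' hcomp_id by blast
      next
        case False
        then have "Poly_Mapping.keys b \<inter> {u. int (mdeg u) = int (Suc e)} = {}"
          using e' by (auto simp: homogeneous_deg_def)
        then show ?thesis using that unfolding hcomp_def by (blast intro: restr_eq_0)
      qed
      then show ?thesis
      proof cases
        case 1
        then show ?thesis using step.hyps by (auto intro: ideal.span_base)
      qed (simp add: ideal.span_zero)
    qed
    ultimately show ?case using step.IH
      by (simp add: partial_deriv_add partial_deriv_Const_mult ideal.span_add ideal.span_scale)
  qed
  show "ideal_gen (mon ` grad_exps A) \<subseteq> ?G"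
    unfolding ideal_gen_def[of "mon ` grad_exps A"]
  proof (rule ideal.span_minimal)
    show "ideal.subspace ?G" unfolding ideal_gen_def by (rule ideal.subspace_span)
    show "mon ` grad_exps A \<subseteq> ?G"
    proof
      fix g :: "('n, 'k) mpoly" assume "g \<in> mon ` grad_exps A"
      then obtain u i where u: "u \<in> A" "i \<in> supp u" and g: "g = mon (u - Poly_Mapping.single i 1)"
        by (auto simp: grad_exps_def)
      let ?c = "of_nat (Poly_Mapping.lookup u i) :: 'k"
      have c: "?c \<noteq> 0" using u(2) char by (simp add: of_nat_eq_0_iff_char_dvd supp_def in_keys_iff)
      have "(mon u :: ('n, 'k) mpoly) \<in> ideal_gen B"
        unfolding B ideal_gen_mon using u(1) subset_multiples[of A] by auto
      then have "partial_deriv i (hcomp (int (Suc e)) (mon u :: ('n, 'k) mpoly)) \<in> ?G" by (rule lowest)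
      moreover have "hcomp (int (Suc e)) (mon u :: ('n, 'k) mpoly) = mon u"
        by (rule hcomp_id) (simp add: homogeneous_deg_def mon_def A[OF u(1)])
      ultimately have "partial_deriv i (mon u :: ('n, 'k) mpoly) \<in> ?G" by (simp only:)
      then have "Poly_Mapping.single 0 (inverse ?c) * partial_deriv i (mon u :: ('n, 'k) mpoly) \<in> ?G"
        unfolding ideal_gen_def by (rule ideal.span_scale)
      moreover have "Poly_Mapping.single 0 (inverse ?c) * partial_deriv i (mon u :: ('n, 'k) mpoly) = g"
        unfolding partial_deriv_mon mult_single g using c by (simp add: mon_def)
      ultimately show "g \<in> ?G" by (simp only:)
    qed
  qed
qed

text \<open>This provides a witness for the choice of generators in \<open>gradient_ideal\<close>.\<close>

lemma min_homogeneous_gens_mon: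
  fixes A :: "'n expo set"
  assumes A: "\<And>a. a \<in> A \<Longrightarrow> mdeg a = e"
  shows "min_homogeneous_gens (mon ` A) (ideal_gen (mon ` A) :: ('n, 'k::comm_ring_1) mpoly set)"
  unfolding min_homogeneous_gens_def
proof (intro conjI ballI allI impI)
  fix f :: "('n, 'k) mpoly" assume "f \<in> mon ` A"
  then show "homogeneous f" by (auto simp: homogeneous_def homogeneous_deg_def mon_def)
next
  fix B :: "('n, 'k) mpoly set" assume B: "B \<subset> mon ` A"
  define A' where "A' = {a \<in> A. mon a \<in> B}"
  have B': "B = mon ` A'" using B by (auto simp: A'_def)
  show "ideal_gen B \<noteq> ideal_gen (mon ` A)"
  proof
    assume "ideal_gen B = ideal_gen (mon ` A)"
    then have "min_mon_gens (ideal_gen (mon ` A') :: ('n, 'k) mpoly set)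
        = min_mon_gens (ideal_gen (mon ` A) :: ('n, 'k) mpoly set)" by (simp add: B')
    moreover have "min_mon_gens (ideal_gen (mon ` A') :: ('n, 'k) mpoly set) = A'"
      by (rule min_mon_gens_ideal_gen[where e = e]) (use A in \<open>auto simp: A'_def\<close>)
    moreover have "min_mon_gens (ideal_gen (mon ` A) :: ('n, 'k) mpoly set) = A"
      by (rule min_mon_gens_ideal_gen, rule A)
    ultimately have "A' = A" by simp
    then show False using B B' by simp
  qed
qed simp

theorem gradient_ideal_mon:
  fixes A :: "'n expo set"
  defines "I \<equiv> ideal_gen (mon ` A) :: ('n, 'k::field) mpoly set"
  assumes A: "\<And>a. a \<in> A \<Longrightarrow> mdeg a = Suc e" and char: "CHAR('k) = 0 \<or> gradient_by_monomials I"
  shows "gradient_ideal I = ideal_gen (mon ` grad_exps A)"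
  using char
proof
  assume c: "CHAR('k) = 0"
  define B where "B = (SOME B. min_homogeneous_gens B I)"
  have "min_homogeneous_gens B I"
    unfolding B_def I_def by (rule someI, rule min_homogeneous_gens_mon, rule A)
  then have "\<forall>f\<in>B. homogeneous f" "ideal_gen B = ideal_gen (mon ` A)"
    by (simp_all add: min_homogeneous_gens_def I_def)
  then show ?thesis
    unfolding gradient_ideal_def B_def[symmetric] using A c by (intro ideal_gen_partial_derivs)
next
  assume "gradient_by_monomials I"
  moreover have "min_mon_gens I = A" unfolding I_def by (rule min_mon_gens_ideal_gen, rule A)
  moreover have "{mon (u - Poly_Mapping.single i 1) :: ('n, 'k) mpoly | u i. u \<in> A \<and> i \<in> supp u} = mon ` grad_exps A"
    by (auto simp: grad_exps_def)
  ultimately show ?thesis by (simp add: gradient_by_monomials_def)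
qed

lemma grad_exps_sqfree_expo:
  fixes X :: "'n::finite set set"
  shows "grad_exps (sqfree_expo ` X) = sqfree_expo ` shadow X"
proof -
  have "sqfree_expo T - Poly_Mapping.single i 1 = sqfree_expo (T - {i})" if "i \<in> T" for T :: "'n set" and i
    using sqfree_expo_remove[OF that] by simp
  then have eq: "{sqfree_expo T - Poly_Mapping.single i 1 | T i. T \<in> X \<and> i \<in> T}
      = {sqfree_expo (T - {i}) | T i. T \<in> X \<and> i \<in> T}" by metis
  have "grad_exps (sqfree_expo ` X) = {sqfree_expo T - Poly_Mapping.single i 1 | T i. T \<in> X \<and> i \<in> T}"
  proof -
    have "grad_exps (sqfree_expo ` X)
        = {sqfree_expo T - Poly_Mapping.single i 1 | T i. T \<in> X \<and> i \<in> supp (sqfree_expo T)}"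
      unfolding grad_exps_def by blast
    then show ?thesis by (simp only: supp_sqfree_expo)
  qed
  also have "\<dots> = sqfree_expo ` shadow X" unfolding eq shadow_def by blast
  finally show ?thesis .
qed

lemma gradient_sqfree_ideal:
  fixes X :: "'n::finite set set"
  assumes "X \<subseteq> subsets_of_card UNIV (Suc e)"
    and "CHAR('k) = 0 \<or> gradient_by_monomials (sqfree_ideal X :: ('n, 'k::field) mpoly set)"
  shows "gradient_ideal (sqfree_ideal X :: ('n, 'k) mpoly set) = sqfree_ideal (shadow X)"
  unfolding sqfree_ideal_def grad_exps_sqfree_expo[symmetric]
  by (rule gradient_ideal_mon[where e = e])
     (use assms in \<open>auto simp: sqfree_ideal_def mdeg_sqfree_expo subsets_of_card_def\<close>)

section \<open>Iterated gradient ideals of squarefree ideals with many generators\<close>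

text \<open>The invariant of the iteration. For \<open>d = 0\<close> the truncated bound is \<open>0\<close>, and \<open>X\<close> is \<open>{{}}\<close>, the family of the
  unit ideal.\<close>

definition few_missing :: "'n::finite set set \<Rightarrow> nat \<Rightarrow> bool"
  where "few_missing X d \<longleftrightarrow> X \<noteq> {} \<and> X \<subseteq> subsets_of_card UNIV d \<and> card (missing UNIV d X) \<le> 2 * d - 1"

text \<open>The shadow misses at most one set, which is within the bound \<open>2e - 1\<close> if \<open>e \<ge> 1\<close>; for \<open>e = 0\<close> it is \<open>{{}}\<close>
  and misses none.\<close>

lemma few_missing_shadow:
  fixes X :: "'n::finite set set"
  assumes X: "few_missing X (Suc e)" and n: "2 * Suc e \<le> CARD('n)"
  shows "few_missing (shadow X) e"
proof -
  have sub: "shadow X \<subseteq> subsets_of_card UNIV e"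
    using shadow_subset[of UNIV X "Suc e"] X by (simp add: few_missing_def)
  obtain T where T: "T \<in> X" "card T = Suc e" using X by (auto simp: few_missing_def subsets_of_card_def)
  then obtain i where "i \<in> T" by (metis card_eq_SucD insertI1)
  then have ne: "shadow X \<noteq> {}" using T by (auto simp: shadow_def)
  have "card (missing UNIV e (shadow X)) \<le> 2 * e - 1"
  proof (cases "e = 0")
    case True
    then have "subsets_of_card (UNIV :: 'n set) e = {{}}" by (auto simp: subsets_of_card_def)
    then show ?thesis using sub ne by (auto simp: missing_def)
  next
    case False
    then show ?thesis
      using card_missing_shadow[of UNIV X "Suc e"] X n by (simp add: few_missing_def)
  qed
  then show ?thesis using sub ne by (simp add: few_missing_def)
qed

lemma iterated_gradient_sqfree_ideal:
  fixes X :: "'n::finite set set"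
  defines "I \<equiv> sqfree_ideal X :: ('n, 'k::field) mpoly set"
  assumes X: "few_missing X d" and n: "2 * d \<le> CARD('n)"
    and char: "CHAR('k) = 0 \<or> (\<forall>l<d. gradient_by_monomials ((gradient_ideal ^^ l) I))"
    and "l \<le> d"
  shows "(gradient_ideal ^^ l) I = sqfree_ideal ((shadow ^^ l) X) \<and> few_missing ((shadow ^^ l) X) (d - l)"
  using \<open>l \<le> d\<close>
proof (induction l)
  case 0
  then show ?case using X by (simp add: I_def)
next
  case (Suc l)
  then have IH: "(gradient_ideal ^^ l) I = sqfree_ideal ((shadow ^^ l) X)"
    "few_missing ((shadow ^^ l) X) (Suc (d - Suc l))" by (simp_all add: Suc_diff_Suc)
  have "CHAR('k) = 0 \<or> gradient_by_monomials (sqfree_ideal ((shadow ^^ l) X) :: ('n, 'k) mpoly set)"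
    using char Suc.prems by (metis IH(1) Suc_le_eq)
  then have "gradient_ideal (sqfree_ideal ((shadow ^^ l) X) :: ('n, 'k) mpoly set)
      = sqfree_ideal (shadow ((shadow ^^ l) X))"
    using IH(2) by (intro gradient_sqfree_ideal[where e = "d - Suc l"]) (simp_all add: few_missing_def)
  moreover have "few_missing (shadow ((shadow ^^ l) X)) (d - Suc l)"
    by (rule few_missing_shadow[OF IH(2)]) (use n Suc.prems in simp)
  ultimately show ?case by (simp add: IH(1))
qed

lemma reg_vertex_splittable_sqfree_ideal:
  fixes X :: "'n::finite set set"
  assumes "vertex_splittable (sqfree_ideal X :: ('n, 'k::field) mpoly set)"
    and "X \<noteq> {}" "X \<subseteq> subsets_of_card UNIV e"
  shows "reg (sqfree_ideal X :: ('n, 'k) mpoly set) = int e"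
proof -
  have deg: "mdeg a = e" if "a \<in> sqfree_expo ` X" for a
    using that assms(3) by (auto simp: mdeg_sqfree_expo subsets_of_card_def)
  have "min_mon_gens (sqfree_ideal X :: ('n, 'k) mpoly set) = sqfree_expo ` X"
    unfolding sqfree_ideal_def by (rule min_mon_gens_ideal_gen, rule deg)
  then have "\<forall>u\<in>min_mon_gens (sqfree_ideal X :: ('n, 'k) mpoly set). int (mdeg u) = int e"
    using deg by simp
  then have "linear_homology F (sqfree_ideal X) (int e)"
    if "graded_free_resolution_of_K F" for F :: "('n, 'k) free_complex"
    using vertex_splittable_in_linear_homology[OF that] assms(1) by (auto simp: vertex_splittable_def)
  then show ?thesis
    unfolding sqfree_ideal_def
    by (intro reg_linear graded_free_resolution_of_K_exists deg) (use assms(2) in auto)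
qed

text \<open>A squarefree monomial is determined by its support.\<close>

lemma squarefree_monomial_ideal_eq_sqfree_ideal:
  fixes I :: "('n::finite, 'k::comm_ring_1) mpoly set"
  assumes "squarefree_monomial_ideal I" "generated_in_degree I d"
  obtains X where "I = sqfree_ideal X" "X \<noteq> {}" "X \<subseteq> subsets_of_card UNIV d"
proof
  let ?A = "min_mon_gens I"
  let ?X = "supp ` ?A"
  have "sqfree_expo (supp u) = u" if "u \<in> ?A" for u
  proof (rule poly_mapping_eqI)
    fix i
    have "Poly_Mapping.lookup u i \<le> 1" using assms(1) that by (simp add: squarefree_monomial_ideal_def)
    then show "Poly_Mapping.lookup (sqfree_expo (supp u)) i = Poly_Mapping.lookup u i"
      by (auto simp: lookup_sqfree_expo supp_def in_keys_iff)
  qed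
  then have A: "sqfree_expo ` ?X = ?A" by (auto simp: image_image)
  have "I = ideal_gen (mon ` ?A)"
    unfolding ideal_gen_mon
    by (rule monomial_ideal_eq_mon_span) (use assms(1) in \<open>simp add: squarefree_monomial_ideal_def\<close>)
  then show I: "I = sqfree_ideal ?X" by (simp only: sqfree_ideal_def A)
  show "?X \<noteq> {}"
  proof
    assume "?X = {}"
    then have "I = {0}" using I by (simp add: sqfree_ideal_def ideal_gen_def)
    then show False using assms(2) by (simp add: generated_in_degree_def)
  qed
  show "?X \<subseteq> subsets_of_card UNIV d"
  proof
    fix T assume "T \<in> ?X"
    then have "sqfree_expo T \<in> ?A" using A by blast
    then have "mdeg (sqfree_expo T) = d" using assms(2) by (simp add: generated_in_degree_def)
    then show "T \<in> subsets_of_card UNIV d" by (simp add: mdeg_sqfree_expo subsets_of_card_def)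
  qed
qed

theorem theorem5p1:
  fixes I :: "('n::finite, 'k::field) mpoly set" and d :: nat
  assumes "squarefree_monomial_ideal I"
    and "generated_in_degree I d"
    and "CHAR('k) = 0 \<or> (\<forall>l<d. gradient_by_monomials ((gradient_ideal ^^ l) I))"
    and "int (min_num_gens I) \<ge> int (CARD('n) choose d) - 2 * int d + 1"
    and "CARD('n) \<ge> 2 * d"
  shows "\<forall>l\<le>d. vertex_splittable ((gradient_ideal ^^ l) I)
           \<and> reg ((gradient_ideal ^^ l) I) = int d - int l"
proof (intro allI impI)
  obtain X where I: "I = sqfree_ideal X" and X: "X \<noteq> {}" "X \<subseteq> subsets_of_card UNIV d"
    using squarefree_monomial_ideal_eq_sqfree_ideal[OF assms(1,2)] .
  have "min_num_gens I \<le> card (mon ` sqfree_expo ` X :: ('n, 'k) mpoly set)"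
    unfolding min_num_gens_def
    by (rule Least_le, rule exI[of _ "mon ` sqfree_expo ` X"]) (simp add: I sqfree_ideal_def)
  also have "\<dots> \<le> card X"
    by (rule order_trans[OF card_image_le card_image_le]) auto
  finally have "card (missing UNIV d X) \<le> 2 * d - 1"
    using card_missing[OF finite X(2)] assms(4) by simp
  then have few: "few_missing X d" using X by (simp add: few_missing_def)
  fix l assume l: "l \<le> d"
  define Y where "Y = (shadow ^^ l) X"
  have Y: "(gradient_ideal ^^ l) I = sqfree_ideal Y" "few_missing Y (d - l)"
    using iterated_gradient_sqfree_ideal[OF few assms(5) _ l, where 'k = 'k] assms(3) by (auto simp: I Y_def)
  then have vs: "vertex_splittable (sqfree_ideal Y :: ('n, 'k) mpoly set)"
    unfolding vertex_splittable_def few_missing_def by (blast intro: vertex_splittable_in_few_missing)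
  moreover have "reg (sqfree_ideal Y :: ('n, 'k) mpoly set) = int (d - l)"
    using Y(2) by (intro reg_vertex_splittable_sqfree_ideal vs) (auto simp: few_missing_def)
  ultimately show "vertex_splittable ((gradient_ideal ^^ l) I) \<and> reg ((gradient_ideal ^^ l) I) = int d - int l"
    using l by (simp add: Y(1) of_nat_diff)
qed

end
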